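(* Let $G$ be a connected graph with maximum average degree $\mathrm{mad}(G)=m$. Then: (i) if $m<\frac{8}{3}$ then $\chi_{\rm pcf}(G)\le6$; (ii) if $m<\frac{5}{2}$ then $\chi_{\rm pcf}(G)\le5$; (iii) if $m<\frac{24}{11}$ then $\chi_{\rm pcf}(G)\le4$, unless $G\in\mathcal{F}$, where $\mathcal{F}$ is the family of all non-trivial connected graphs in which every block is isomorphic to $C_5$.
   Context: All graphs are simple, finite and undirected. A vertex coloring of a graph is proper if adjacent vertices get distinct colors. It is conflict-free (with respect to open neighborhoods) if for every non-isolated vertex $x$ there is a color that appears exactly once on the open neighborhood $N(x)$. A PCF $k$-coloring is a vertex coloring with at most $k$ colors that is both proper and conflict-free. The PCF chromatic number $\chi_{\rm pcf}(G)$ is the minimum $k$ for which $G$ admits a PCF $k$-coloring. The average degree of a graph $H$ is $\mathrm{ad}(H)=2|E(H)|/|V(H)|$, and the maximum average degree is $\mathrm{mad}(G)=\max_{H\subseteq G}\mathrm{ad}(H)$, the maximum over subgraphs $H$ of $G$ with at least one vertex. A non-trivial graph is one with at least two vertices. *)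

theory Defs
  imports Complex_Main "Graph_Theory.Graph_Theory"
begin

text \<open>
  A simple finite undirected graph is a \<^locale>\<open>pair_graph\<close>: a finite, loop-free, symmetric
  arc relation on a finite vertex set.  An undirected edge corresponds to two opposite arcs.
\<close>

definition edges :: "'a pair_pre_digraph \<Rightarrow> 'a set set" where
  "edges G = {{u, v} | u v. (u, v) \<in> parcs G}"

definition nbhd :: "'a pair_pre_digraph \<Rightarrow> 'a \<Rightarrow> 'a set" where
  "nbhd G x = {y. (x, y) \<in> parcs G}"

definition average_degree :: "'a pair_pre_digraph \<Rightarrow> real" where
  "average_degree H = 2 * real (card (edges H)) / real (card (pverts H))"

text \<open>
  \<^const>\<open>subgraph\<close> is a notion for digraphs; requiring \<^term>\<open>pair_graph H\<close> makes the arc set of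
  a subgraph symmetric again.
\<close>

definition mad :: "'a pair_pre_digraph \<Rightarrow> real" where
  "mad G = Max {average_degree H | H.
     pair_graph H \<and> subgraph (with_proj H) (with_proj G) \<and> pverts H \<noteq> {}}"

definition proper_coloring :: "'a pair_pre_digraph \<Rightarrow> ('a \<Rightarrow> nat) \<Rightarrow> bool" where
  "proper_coloring G c \<longleftrightarrow> (\<forall>(u, v) \<in> parcs G. c u \<noteq> c v)"

definition conflict_free :: "'a pair_pre_digraph \<Rightarrow> ('a \<Rightarrow> nat) \<Rightarrow> bool" where
  "conflict_free G c \<longleftrightarrow>
     (\<forall>x \<in> pverts G. nbhd G x \<noteq> {} \<longrightarrow> (\<exists>i. card {y \<in> nbhd G x. c y = i} = 1))"

definition pcf_coloring :: "'a pair_pre_digraph \<Rightarrow> nat \<Rightarrow> ('a \<Rightarrow> nat) \<Rightarrow> bool" where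
  "pcf_coloring G k c \<longleftrightarrow>
     card (c ` pverts G) \<le> k \<and> proper_coloring G c \<and> conflict_free G c"

definition pcf_chromatic_number :: "'a pair_pre_digraph \<Rightarrow> nat" (\<open>\<chi>\<^sub>p\<^sub>c\<^sub>f\<close>) where
  "\<chi>\<^sub>p\<^sub>c\<^sub>f G = (LEAST k. \<exists>c. pcf_coloring G k c)"

definition cut_vertex :: "('a, 'b) pre_digraph \<Rightarrow> 'a \<Rightarrow> bool" where
  "cut_vertex H v \<longleftrightarrow> v \<in> verts H \<and>
     (\<exists>u \<in> verts H - {v}. \<exists>w \<in> verts H - {v}.
        u \<rightarrow>\<^sup>*\<^bsub>H\<^esub> w \<and> \<not> u \<rightarrow>\<^sup>*\<^bsub>pre_digraph.del_vert H v\<^esub> w)"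

text \<open>
  A block is a maximal connected subgraph without a cut vertex (of its own).  The name
  \<open>connected\<close> is qualified because the topological notion is in scope as well.
\<close>

definition block :: "'a pair_pre_digraph \<Rightarrow> 'a pair_pre_digraph \<Rightarrow> bool" where
  "block G B \<longleftrightarrow> pre_digraph.max_subgraph (with_proj G)
     (\<lambda>H. graph H \<and> Digraph_Component.connected H \<and> (\<nexists>v. cut_vertex H v)) (with_proj B)"

definition cycle_graph :: "nat \<Rightarrow> nat pair_pre_digraph" where
  "cycle_graph n = \<lparr> pverts = {..<n},
     parcs = {(i, j). i < n \<and> j < n \<and> (j = Suc i mod n \<or> i = Suc j mod n)} \<rparr>"

definition C5_block_graphs :: "'a pair_pre_digraph set" (\<open>\<F>\<close>) where
  "\<F> = {G. pair_graph G \<and> Digraph_Component.connected (with_proj G) \<and> 2 \<le> card (pverts G) \<and>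
     (\<forall>B. block G B \<longrightarrow> digraph_iso (with_proj B) (with_proj (cycle_graph 5)))}"

text \<open>
  The maximum and the minimum above are genuine: the first set is finite and nonempty, and some
  colouring exists.
\<close>

lemma finite_mad_set:
  assumes "pair_graph G"
  shows "finite {average_degree H | H.
     pair_graph H \<and> subgraph (with_proj H) (with_proj G) \<and> pverts H \<noteq> {}}"
proof -
  interpret pair_graph G by fact
  have "H \<in> (\<lambda>(V, A). \<lparr> pverts = V, parcs = A \<rparr>) ` (Pow (pverts G) \<times> Pow (parcs G))"
    if "subgraph (with_proj H) (with_proj G)" for H :: "'a pair_pre_digraph"
  proof -
    have "H = (case (pverts H, parcs H) of (V, A) \<Rightarrow> \<lparr> pverts = V, parcs = A \<rparr>)"
      by simp
    moreover have "(pverts H, parcs H) \<in> Pow (pverts G) \<times> Pow (parcs G)"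
      using that by (simp add: subgraph_def)
    ultimately show ?thesis by (rule image_eqI)
  qed
  then have "finite {H. subgraph (with_proj H) (with_proj G)}"
    using finite_subset[OF subsetI finite_imageI[OF finite_cartesian_product]]
      pair_finite_verts pair_finite_arcs by (metis finite_Pow_iff mem_Collect_eq)
  then have "finite (average_degree ` {H. subgraph (with_proj H) (with_proj G)})"
    by (rule finite_imageI)
  then show ?thesis
    by (rule rev_finite_subset) auto
qed

lemma average_degree_le_mad:
  assumes "pair_graph G" "pair_graph H" "subgraph (with_proj H) (with_proj G)" "pverts H \<noteq> {}"
  shows "average_degree H \<le> mad G"
  unfolding mad_def using assms by (intro Max_ge finite_mad_set) auto

lemma ex_pcf_coloring:
  assumes "pair_graph G"
  shows "\<exists>c. pcf_coloring G (\<chi>\<^sub>p\<^sub>c\<^sub>f G) c"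
proof -
  interpret pair_graph G by fact
  obtain c :: "'a \<Rightarrow> nat" where c: "inj_on c (pverts G)"
    using pair_finite_verts finite_imp_inj_to_nat_seg by metis
  have "proper_coloring G c"
    unfolding proper_coloring_def
  proof clarify
    fix u v assume "(u, v) \<in> parcs G" "c u = c v"
    then show False
      using inj_onD[OF c] in_arcsD1 in_arcsD2 no_loops' by metis
  qed
  moreover have "conflict_free G c"
    unfolding conflict_free_def
  proof (intro ballI impI)
    fix x assume "nbhd G x \<noteq> {}"
    then obtain y where y: "y \<in> nbhd G x" by blast
    then have "{z \<in> nbhd G x. c z = c y} = {y}"
      using inj_onD[OF c] in_arcsD2 unfolding nbhd_def by blast
    then show "\<exists>i. card {z \<in> nbhd G x. c z = i} = 1"
      by (intro exI[of _ "c y"]) simp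
  qed
  ultimately have "\<exists>k c. pcf_coloring G k c"
    by (auto simp: pcf_coloring_def)
  then show ?thesis
    unfolding pcf_chromatic_number_def by (rule LeastI_ex)
qed

end

theory Submission
  imports Defs
begin

text \<open>
  Both bounds come from minimal counterexamples, in which only sets of vertices are deleted.
  If \<open>mad G < 8/3\<close>, double counting produces a vertex of degree at most 1, two adjacent vertices of
  degree 2, or a vertex of degree 3 with two neighbours of degree 2.  Each of these can be deleted and
  coloured last, since a new vertex only has to avoid the colours of a few neighbours and the colours
  that are already unique in the neighbourhoods it enters; five colours suffice, so that (i) and (ii)
  hold together.

  If \<open>mad G < 24/11\<close> and there is no leaf, some path of four vertices of degree 2 exists.  Unless it
  closes up to a pendant 5-cycle, it can be coloured last with four colours.  A pendant 5-cycle at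
  \<open>x\<close> forces equal colours on the two neighbours of \<open>x\<close> in it, which does no harm as soon as some
  colour is unique at \<open>x\<close> elsewhere.  The exceptional graphs are therefore those built from a single
  vertex by attaching pendant 5-cycles.  When such a graph appears after a deletion, it still has a
  colouring that fails only at one prescribed vertex, whose neighbourhood is monochromatic, and a
  single new neighbour of another colour repairs that vertex.
\<close>

section \<open>Colourings of vertex subsets and their extension to deleted vertices\<close>

locale simple_adjacency =
  fixes E :: "('a \<times> 'a) set"
  assumes E_sym: "(x, y) \<in> E \<Longrightarrow> (y, x) \<in> E"
    and E_irrefl: "(x, x) \<notin> E"
begin

text \<open>The relation \<open>E\<close> stays fixed and only the vertex set varies, so an induced
  subgraph is just a set and deleting vertices is set difference.\<close>

definition nb :: "'a set \<Rightarrow> 'a \<Rightarrow> 'a set" where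
  "nb W x = {y \<in> W. (x, y) \<in> E}"

definition unique_at :: "'a set \<Rightarrow> ('a \<Rightarrow> nat) \<Rightarrow> 'a \<Rightarrow> nat \<Rightarrow> bool" where
  "unique_at W c x i \<longleftrightarrow> (\<exists>w \<in> nb W x. c w = i \<and> (\<forall>y \<in> nb W x. c y = i \<longrightarrow> y = w))"

text \<open>The defect that a single new neighbour can repair. It holds vacuously for every
  \<open>i\<close> when \<open>x\<close> has no neighbours in \<open>W\<close>.\<close>

definition mono_at :: "'a set \<Rightarrow> ('a \<Rightarrow> nat) \<Rightarrow> 'a \<Rightarrow> nat \<Rightarrow> bool" where
  "mono_at W c x i \<longleftrightarrow> (\<forall>y \<in> nb W x. c y = i)"

text \<open>Colours come from an initial segment of the naturals, so that a free colour can be found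
  by counting the forbidden ones.\<close>

definition proper_on :: "'a set \<Rightarrow> nat \<Rightarrow> ('a \<Rightarrow> nat) \<Rightarrow> bool" where
  "proper_on W k c \<longleftrightarrow> (\<forall>v \<in> W. c v < k) \<and> (\<forall>u \<in> W. \<forall>v \<in> nb W u. c u \<noteq> c v)"

definition pcf_on :: "'a set \<Rightarrow> nat \<Rightarrow> ('a \<Rightarrow> nat) \<Rightarrow> bool" where
  "pcf_on W k c \<longleftrightarrow> proper_on W k c \<and> (\<forall>x \<in> W. nb W x \<noteq> {} \<longrightarrow> (\<exists>i. unique_at W c x i))"

lemma nb_subset: "nb W x \<subseteq> W"
  by (auto simp: nb_def)

lemma finite_nb: "finite W \<Longrightarrow> finite (nb W x)"
  using finite_subset nb_subset by blast

lemma nb_mono: "U \<subseteq> W \<Longrightarrow> nb U x \<subseteq> nb W x"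
  by (auto simp: nb_def)

lemma nb_symD: "y \<in> nb W x \<Longrightarrow> x \<in> W \<Longrightarrow> x \<in> nb W y"
  by (auto simp: nb_def E_sym)

lemma not_in_nb: "x \<notin> nb W x"
  by (simp add: nb_def E_irrefl)

lemma nb_Diff: "nb (W - P) x = nb W x - P"
  by (auto simp: nb_def)

lemma unique_at_inj:
  assumes "inj_on c (nb W x)" "y \<in> nb W x"
  shows "unique_at W c x (c y)"
  using assms unfolding unique_at_def by (auto dest: inj_onD)

lemma unique_at_extend:
  assumes "unique_at U c x i" "U \<subseteq> W" "\<And>v. v \<in> U \<Longrightarrow> c' v = c v"
    and "\<And>p. p \<in> nb W x - U \<Longrightarrow> c' p \<noteq> i"
  shows "unique_at W c' x i"
proof -
  obtain w where w: "w \<in> nb U x" "c w = i" "\<And>y. y \<in> nb U x \<Longrightarrow> c y = i \<Longrightarrow> y = w"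
    using assms(1) unfolding unique_at_def by blast
  have "w \<in> nb W x" "c' w = i"
    using w(1,2) assms(2) assms(3)[of w] by (auto simp: nb_def)
  moreover have "y = w" if "y \<in> nb W x" "c' y = i" for y
  proof -
    have "y \<in> U" using assms(4)[of y] that by blast
    then show ?thesis using w(3)[of y] that assms(3)[of y] by (simp add: nb_def)
  qed
  ultimately show ?thesis unfolding unique_at_def by blast
qed

text \<open>The repair: all old neighbours share a colour, so one new neighbour of another colour is
  alone in its colour.\<close>

lemma mono_at_extend:
  assumes "mono_at U c x i" "\<And>v. v \<in> U \<Longrightarrow> c' v = c v"
    and "nb W x - U = {p}" "c' p \<noteq> i"
  shows "unique_at W c' x (c' p)"
proof -
  have "y = p" if "y \<in> nb W x" "c' y = c' p" for y
  proof (cases "y \<in> U")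
    case True
    then have "y \<in> nb U x" using that(1) by (simp add: nb_def)
    then show ?thesis using assms(1,4) that(2) assms(2)[OF True] by (simp add: mono_at_def)
  next
    case False
    then show ?thesis using that(1) assms(3) by blast
  qed
  moreover have "p \<in> nb W x" using assms(3) by blast
  ultimately show ?thesis unfolding unique_at_def by blast
qed

lemma proper_on_extend:
  assumes "proper_on U k c" "U \<subseteq> W" "\<And>v. v \<in> U \<Longrightarrow> c' v = c v"
    and "\<And>p. p \<in> W - U \<Longrightarrow> c' p < k"
    and "\<And>p q. p \<in> W - U \<Longrightarrow> q \<in> nb W p \<Longrightarrow> c' p \<noteq> c' q"
  shows "proper_on W k c'"
  unfolding proper_on_def
proof (intro conjI ballI)
  fix v assume "v \<in> W"
  then show "c' v < k"
    using assms unfolding proper_on_def by (cases "v \<in> U") auto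
next
  fix u v assume uv: "u \<in> W" "v \<in> nb W u"
  then have "u \<in> nb W v" "v \<in> W" using nb_symD nb_subset[of W u] by auto
  consider "u \<notin> U" | "v \<notin> U" | "u \<in> U" "v \<in> U" by blast
  then show "c' u \<noteq> c' v"
  proof cases
    case 1 then show ?thesis using assms(5) uv by blast
  next
    case 2 then show ?thesis using assms(5)[of v u] \<open>u \<in> nb W v\<close> \<open>v \<in> W\<close> by auto
  next
    case 3
    then have "v \<in> nb U u" using uv by (auto simp: nb_def)
    then show ?thesis using 3 assms(1,3) unfolding proper_on_def by auto
  qed
qed

text \<open>The common step of the reductions. An old vertex is safe in one of three ways: its
  neighbours are coloured injectively, no new neighbour takes its unique colour, or its
  monochromatic neighbourhood gains exactly one vertex of another colour.\<close>

lemma pcf_on_extend: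
  assumes "proper_on U k c" "U \<subseteq> W" "\<And>v. v \<in> U \<Longrightarrow> c' v = c v"
    and "\<And>p. p \<in> W - U \<Longrightarrow> c' p < k"
    and "\<And>p q. p \<in> W - U \<Longrightarrow> q \<in> nb W p \<Longrightarrow> c' p \<noteq> c' q"
    and new: "\<And>p. p \<in> W - U \<Longrightarrow> nb W p \<noteq> {} \<Longrightarrow> \<exists>i. unique_at W c' p i"
    and old: "\<And>x. x \<in> U \<Longrightarrow> inj_on c' (nb W x) \<or>
      (\<exists>i. unique_at U c x i \<and> (\<forall>p \<in> nb W x - U. c' p \<noteq> i)) \<or>
      (\<exists>i p. mono_at U c x i \<and> nb W x - U = {p} \<and> c' p \<noteq> i)"
  shows "pcf_on W k c'"
  unfolding pcf_on_def
proof (intro conjI ballI impI)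
  show "proper_on W k c'"
    by (rule proper_on_extend[OF assms(1-5)])
next
  fix x assume x: "x \<in> W" "nb W x \<noteq> {}"
  show "\<exists>i. unique_at W c' x i"
  proof (cases "x \<in> U")
    case False then show ?thesis using new x by blast
  next
    case True
    from old[OF True] consider "inj_on c' (nb W x)"
      | i where "unique_at U c x i" "\<forall>p \<in> nb W x - U. c' p \<noteq> i"
      | i p where "mono_at U c x i" "nb W x - U = {p}" "c' p \<noteq> i" by blast
    then show ?thesis
    proof cases
      case 1 then show ?thesis using unique_at_inj x by blast
    next
      case (2 i)
      have "unique_at W c' x i"
        by (rule unique_at_extend[OF 2(1) assms(2)]) (use 2 assms(3) in auto)
      then show ?thesis by blast
    next
      case (3 i p)
      have "unique_at W c' x (c' p)"
        by (rule mono_at_extend[OF 3(1) _ 3(2)]) (use 3 assms(3) in auto)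
      then show ?thesis by blast
    qed
  qed
qed

text \<open>Forbidden colours come as a list because its length bounds their number whatever
  coincidences occur among them.\<close>

lemma ex_colour_avoiding:
  assumes "length xs < k"
  shows "\<exists>i<k. i \<notin> set xs"
proof (rule ccontr)
  assume "\<not> ?thesis"
  then have "{..<k} \<subseteq> set xs" by auto
  then have "k \<le> card (set xs)" using card_mono[of "set xs" "{..<k}"] by simp
  then show False using assms card_length[of xs] by simp
qed

lemma pcf_on_proper: "pcf_on W k c \<Longrightarrow> proper_on W k c"
  by (simp add: pcf_on_def)

text \<open>A choice function makes \<open>\<phi> x\<close> available for every \<open>x\<close>;
  where it has no meaning, avoiding it costs at most one colour and does no harm.\<close>

lemma pcf_on_reserved_colours:
  assumes "pcf_on W k c"
  obtains \<phi> where "\<And>x. x \<in> W \<Longrightarrow> nb W x = {} \<or> unique_at W c x (\<phi> x)"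
  using assms unfolding pcf_on_def by metis

lemma unique_at_pair:
  assumes "nb W x = {y, z}" "c y \<noteq> c z"
  shows "unique_at W c x (c y)"
  using assms unfolding unique_at_def by auto

lemma unique_at_singleton:
  assumes "nb W x = {y}"
  shows "unique_at W c x (c y)"
  using assms unfolding unique_at_def by auto

section \<open>Five colours\<close>

text \<open>The new vertex avoids the colour of its neighbour and the colour reserved there: two
  constraints.\<close>

lemma pcf_on_insert_degree_le_1:
  assumes "finite W" "v \<in> W" "card (nb W v) \<le> 1" "pcf_on (W - {v}) k c" "3 \<le> k"
  shows "\<exists>c. pcf_on W k c"
proof -
  let ?U = "W - {v}"
  obtain \<phi> where \<phi>: "\<And>x. x \<in> ?U \<Longrightarrow> nb ?U x = {} \<or> unique_at ?U c x (\<phi> x)"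
    using pcf_on_reserved_colours[OF assms(4)] by blast
  have "nb W v = {} \<or> (\<exists>u. nb W v = {u})"
    using assms(3) finite_nb[OF assms(1)] by (metis card_1_singletonE card_eq_0_iff le_Suc_eq le_zero_eq One_nat_def)
  \<comment> \<open>If \<open>v\<close> is isolated, \<open>u\<close> is an arbitrary element and
    the constraints it imposes are harmless.\<close>
  then obtain u where u: "nb W v \<subseteq> {u}" by blast
  obtain a where a: "a < k" "a \<notin> set [c u, \<phi> u]"
    using ex_colour_avoiding[of "[c u, \<phi> u]" k] assms(5) by auto
  have only: "z = u" if "v \<in> nb W z" "z \<in> W" for z
    using nb_symD[OF that] u by auto
  have "pcf_on W k (c(v := a))"
  proof (rule pcf_on_extend[OF pcf_on_proper[OF assms(4)]])
    fix p assume "p \<in> W - ?U" "nb W p \<noteq> {}"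
    then have "nb W p = {u}" using u by auto
    then show "\<exists>i. unique_at W (c(v := a)) p i" using unique_at_singleton by blast
  next
    fix x assume x: "x \<in> ?U"
    show "inj_on (c(v := a)) (nb W x) \<or>
      (\<exists>i. unique_at ?U c x i \<and> (\<forall>p \<in> nb W x - ?U. (c(v := a)) p \<noteq> i)) \<or>
      (\<exists>i p. mono_at ?U c x i \<and> nb W x - ?U = {p} \<and> (c(v := a)) p \<noteq> i)"
    proof (cases "nb ?U x = {}")
      case True
      then have "nb W x \<subseteq> {v}" by (auto simp: nb_Diff)
      then have "inj_on (c(v := a)) (nb W x)" by (auto intro: inj_onI)
      then show ?thesis by blast
    next
      case False
      have "\<forall>p \<in> nb W x - ?U. (c(v := a)) p \<noteq> \<phi> x"
        using only a x nb_subset by fastforce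
      then show ?thesis using \<phi>[OF x] False by blast
    qed
  qed (use u a assms not_in_nb in auto)
  then show ?thesis by blast
qed

text \<open>Besides the colour and the reserved colour of its own outer neighbour, each of
  \<open>u\<close> and \<open>v\<close> avoids the colour of the other's outer neighbour, so both
  see two distinct colours. The second vertex also avoids the first: at most four
  constraints.\<close>

lemma pcf_on_insert_adjacent_2_vertices:
  assumes "u \<in> W" "v \<in> W" "nb W u = {u', v}" "nb W v = {u, v'}" "u' \<noteq> v" "v' \<noteq> u"
    and "pcf_on (W - {u, v}) k c" "5 \<le> k"
  shows "\<exists>c. pcf_on W k c"
proof -
  let ?U = "W - {u, v}"
  obtain \<phi> where \<phi>: "\<And>x. x \<in> ?U \<Longrightarrow> nb ?U x = {} \<or> unique_at ?U c x (\<phi> x)"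
    using pcf_on_reserved_colours[OF assms(7)] by blast
  have neq: "u \<noteq> v" "u' \<noteq> u" "v' \<noteq> v" using assms(3,4) not_in_nb[of u W] not_in_nb[of v W] by auto
  obtain a where a: "a < k" "a \<notin> set [c u', \<phi> u', c v']"
    using ex_colour_avoiding[of "[c u', \<phi> u', c v']" k] assms(8) by auto
  obtain b where b: "b < k" "b \<notin> set [a, c v', \<phi> v', c u']"
    using ex_colour_avoiding[of "[a, c v', \<phi> v', c u']" k] assms(8) by auto
  have u_only: "z = u' \<or> z = v" if "u \<in> nb W z" "z \<in> W" for z
    using nb_symD[OF that] assms(3) by auto
  have v_only: "z = u \<or> z = v'" if "v \<in> nb W z" "z \<in> W" for z
    using nb_symD[OF that] assms(4) by auto
  let ?c = "c(u := a, v := b)"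
  have "pcf_on W k ?c"
  proof (rule pcf_on_extend[OF pcf_on_proper[OF assms(7)]])
    fix p assume "p \<in> W - ?U" "nb W p \<noteq> {}"
    then have "p = u \<or> p = v" by blast
    moreover have "unique_at W ?c u (?c u')"
      by (rule unique_at_pair[OF assms(3)]) (use neq a b assms(5,6) in auto)
    moreover have "unique_at W ?c v (?c u)"
      by (rule unique_at_pair[OF assms(4)]) (use neq a b assms(5,6) in auto)
    ultimately show "\<exists>i. unique_at W ?c p i" by blast
  next
    fix x assume x: "x \<in> ?U"
    show "inj_on ?c (nb W x) \<or>
      (\<exists>i. unique_at ?U c x i \<and> (\<forall>p \<in> nb W x - ?U. ?c p \<noteq> i)) \<or>
      (\<exists>i p. mono_at ?U c x i \<and> nb W x - ?U = {p} \<and> ?c p \<noteq> i)"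
    proof (cases "nb ?U x = {}")
      case True
      then have sub: "nb W x \<subseteq> {u, v}" by (auto simp: nb_Diff)
      \<comment> \<open>An outer vertex may have only \<open>u\<close> and \<open>v\<close> as
        neighbours; their distinct colours settle that case.\<close>
      have "inj_on ?c {u, v}" using b neq by auto
      then have "inj_on ?c (nb W x)" using sub by (rule inj_on_subset)
      then show ?thesis by blast
    next
      case False
      have "?c p \<noteq> \<phi> x" if "p \<in> nb W x - ?U" for p
        using that u_only[of x] v_only[of x] a b x neq nb_subset[of W x] by auto
      then show ?thesis using \<phi>[OF x] False by blast
    qed
  qed (use a b neq assms in auto)
  then show ?thesis by blast
qed

text \<open>First \<open>v\<close> is coloured, against \<open>w\<close> and against
  \<open>a'\<close> and \<open>b'\<close>, so that \<open>a\<close> and \<open>b\<close> see two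
  colours. Next comes \<open>a\<close>, whose colour is to be unique at \<open>v\<close> and so
  differs from that of \<open>w\<close>; last comes \<open>b\<close>, which differs from
  \<open>a\<close>. Each time four colours are forbidden.\<close>

lemma pcf_on_insert_3_vertex:
  assumes "v \<in> W" "a \<in> W" "b \<in> W" "nb W v = {a, b, w}" "card {a, b, w} = 3"
    and "nb W a = {v, a'}" "nb W b = {v, b'}" "a' \<notin> {v, b}" "b' \<notin> {v, a}"
    and "pcf_on (W - {v, a, b}) k c" "5 \<le> k"
  shows "\<exists>c. pcf_on W k c"
proof -
  let ?U = "W - {v, a, b}"
  obtain \<phi> where \<phi>: "\<And>x. x \<in> ?U \<Longrightarrow> nb ?U x = {} \<or> unique_at ?U c x (\<phi> x)"
    using pcf_on_reserved_colours[OF assms(10)] by blast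
  have d: "a \<noteq> b" "a \<noteq> w" "b \<noteq> w" using assms(5) by (auto simp: card_insert_if split: if_splits)
  have neq: "v \<noteq> a" "v \<noteq> b" "v \<noteq> w" "a' \<noteq> a" "b' \<noteq> b" "a' \<noteq> v" "a' \<noteq> b" "b' \<noteq> v" "b' \<noteq> a"
    using assms(4,6-9) not_in_nb[of v W] not_in_nb[of a W] not_in_nb[of b W] by auto
  obtain i where i: "i < k" "i \<notin> set [c w, \<phi> w, c a', c b']"
    using ex_colour_avoiding[of "[c w, \<phi> w, c a', c b']" k] assms(11) by auto
  obtain j where j: "j < k" "j \<notin> set [c a', \<phi> a', i, c w]"
    using ex_colour_avoiding[of "[c a', \<phi> a', i, c w]" k] assms(11) by auto
  obtain l where l: "l < k" "l \<notin> set [c b', \<phi> b', i, j]"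
    using ex_colour_avoiding[of "[c b', \<phi> b', i, j]" k] assms(11) by auto
  have v_only: "z = a \<or> z = b \<or> z = w" if "v \<in> nb W z" "z \<in> W" for z
    using nb_symD[OF that] assms(4) by auto
  have a_only: "z = v \<or> z = a'" if "a \<in> nb W z" "z \<in> W" for z
    using nb_symD[OF that] assms(6) by auto
  have b_only: "z = v \<or> z = b'" if "b \<in> nb W z" "z \<in> W" for z
    using nb_symD[OF that] assms(7) by auto
  let ?c = "c(v := i, a := j, b := l)"
  have "pcf_on W k ?c"
  proof (rule pcf_on_extend[OF pcf_on_proper[OF assms(10)]])
    fix p assume "p \<in> W - ?U" "nb W p \<noteq> {}"
    then have "p = v \<or> p = a \<or> p = b" by blast
    moreover have "unique_at W ?c a (?c v)"
      by (rule unique_at_pair[OF assms(6)]) (use neq i in auto)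
    moreover have "unique_at W ?c b (?c v)"
      by (rule unique_at_pair[OF assms(7)]) (use neq i in auto)
    moreover have "unique_at W ?c v j"
      unfolding unique_at_def using assms(4) neq d j l by auto
    ultimately show "\<exists>i. unique_at W ?c p i" by blast
  next
    fix x assume x: "x \<in> ?U"
    show "inj_on ?c (nb W x) \<or>
      (\<exists>i. unique_at ?U c x i \<and> (\<forall>p \<in> nb W x - ?U. ?c p \<noteq> i)) \<or>
      (\<exists>i p. mono_at ?U c x i \<and> nb W x - ?U = {p} \<and> ?c p \<noteq> i)"
    proof (cases "nb ?U x = {}")
      case True
      then have sub: "nb W x \<subseteq> {v, a, b}" by (auto simp: nb_Diff)
      have "inj_on ?c {v, a, b}" using i j l neq d by auto
      then have "inj_on ?c (nb W x)" using sub by (rule inj_on_subset)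
      then show ?thesis by blast
    next
      case False
      have "?c p \<noteq> \<phi> x" if "p \<in> nb W x - ?U" for p
        using that v_only[of x] a_only[of x] b_only[of x] i j l x neq nb_subset[of W x] by auto
      then show ?thesis using \<phi>[OF x] False by blast
    qed
  qed (use i j l neq d assms in auto)
  then show ?thesis by blast
qed

text \<open>The strict bound \<open>b / a\<close> on the average degree of every nonempty induced
  subgraph, with denominators cleared; the degree sum counts each edge twice.\<close>

definition sparse :: "nat \<Rightarrow> nat \<Rightarrow> 'a set \<Rightarrow> bool" where
  "sparse a b W \<longleftrightarrow>
    (\<forall>U \<subseteq> W. U \<noteq> {} \<longrightarrow> a * (\<Sum>u\<in>U. card (nb U u)) < b * card U)"

lemma sparse_subset: "sparse a b W \<Longrightarrow> U \<subseteq> W \<Longrightarrow> sparse a b U"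
  unfolding sparse_def by blast

lemma sum_card_nb_swap:
  assumes "finite W" "finite S"
  shows "(\<Sum>v\<in>W. card (nb S v)) = (\<Sum>u\<in>S. card (nb W u))"
proof -
  have "(\<Sum>v\<in>W. card {u \<in> S. (v, u) \<in> E}) = (\<Sum>u\<in>S. card (nb W u))"
  proof (rule sum_multicount_gen[OF assms])
    show "\<forall>u\<in>S. card {v \<in> W. (v, u) \<in> E} = card (nb W u)"
      proof
      fix u
      have "{v \<in> W. (v, u) \<in> E} = nb W u" using E_sym by (auto simp: nb_def)
      then show "card {v \<in> W. (v, u) \<in> E} = card (nb W u)" by simp
    qed
  qed
  then show ?thesis by (simp add: nb_def)
qed

text \<open>Discharging: every vertex sends 1/3 to each neighbour of degree 2. A vertex of degree 2
  ends with 2 + 2/3, one of degree 3 loses at most 1/3, and one of degree d at least 4 keeps at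
  least 2d/3, so all end with at least 8/3.\<close>

lemma not_sparse_8_3:
  assumes "finite W" "W \<noteq> {}"
    and deg: "\<And>v. v \<in> W \<Longrightarrow> 2 \<le> card (nb W v)"
    and deg2: "\<And>u v. v \<in> W \<Longrightarrow> u \<in> nb W v \<Longrightarrow> card (nb W v) = 2 \<Longrightarrow> card (nb W u) \<noteq> 2"
    and deg3: "\<And>v. v \<in> W \<Longrightarrow> card (nb W v) = 3 \<Longrightarrow> card {u \<in> nb W v. card (nb W u) = 2} \<le> 1"
  shows "\<not> sparse 3 8 W"
proof -
  define S where "S = {v \<in> W. card (nb W v) = 2}"
  have fS: "finite S" "S \<subseteq> W" using assms(1) by (auto simp: S_def)
  have nbS: "nb S v = {u \<in> nb W v. card (nb W u) = 2}" for v
    by (auto simp: S_def nb_def)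
  \<comment> \<open>The discharging balance times three: \<open>v\<close> sends 1 to each neighbour
    in \<open>S\<close> and receives 2 if it lies in \<open>S\<close> itself.\<close>
  have vertex: "8 + card (nb S v) \<le> 3 * card (nb W v) + (if v \<in> S then 2 else 0)" if v: "v \<in> W" for v
  proof -
    consider "card (nb W v) = 2" | "card (nb W v) = 3" | "4 \<le> card (nb W v)"
      using deg[OF v] by linarith
    then show ?thesis
    proof cases
      case 1
      then have "nb S v = {}" using deg2[OF v] by (auto simp: nbS)
      then show ?thesis using 1 v by (simp add: S_def)
    next
      case 2
      then show ?thesis using deg3[OF v] by (simp add: nbS)
    next
      case 3
      have "card (nb S v) \<le> card (nb W v)"
        using card_mono[OF finite_nb[OF assms(1)] nb_mono[OF fS(2)]] .
      then show ?thesis using 3 by simp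
    qed
  qed
  \<comment> \<open>What is sent equals what is received: the arcs between \<open>W\<close> and
    \<open>S\<close> are counted from either end.\<close>
  have "(\<Sum>v\<in>W. card (nb S v)) = (\<Sum>u\<in>S. 2)"
    unfolding sum_card_nb_swap[OF assms(1) fS(1)] by (rule sum.cong) (auto simp: S_def)
  then have nbS_sum: "(\<Sum>v\<in>W. card (nb S v)) = 2 * card S" by simp
  have "(\<Sum>v\<in>W. if v \<in> S then 2 else 0) = (2::nat) * card S"
    using fS assms(1) by (simp add: sum.If_cases Int_absorb1)
  moreover have "(\<Sum>v\<in>W. 8 + card (nb S v)) \<le> (\<Sum>v\<in>W. 3 * card (nb W v) + (if v \<in> S then 2 else 0))"
    by (rule sum_mono) (rule vertex)
  ultimately have "8 * card W \<le> 3 * (\<Sum>v\<in>W. card (nb W v))"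
    by (simp add: sum.distrib nbS_sum sum_distrib_left)
  then show ?thesis using assms(2) unfolding sparse_def by (meson leD subset_refl)
qed

theorem sparse_8_3_pcf_5:
  assumes "finite W" "sparse 3 8 W"
  shows "\<exists>c. pcf_on W 5 c"
  using assms
proof (induction "card W" arbitrary: W rule: less_induct)
  case less
  have IH: "\<exists>c. pcf_on (W - P) 5 c" if "P \<inter> W \<noteq> {}" for P
  proof -
    have "card (W - P) < card W"
      by (rule psubset_card_mono) (use less.prems that in auto)
    then show ?thesis using less sparse_subset by (meson Diff_subset finite_Diff)
  qed
  \<comment> \<open>The last case records that no two vertices of degree 2 are adjacent, which keeps
    the two chosen neighbours of \<open>v\<close> nonadjacent.\<close>
  consider "W = {}" | v where "v \<in> W" "card (nb W v) \<le> 1"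
    | u v where "v \<in> W" "u \<in> nb W v" "card (nb W u) = 2" "card (nb W v) = 2"
    | v where "v \<in> W" "card (nb W v) = 3" "\<not> card {u \<in> nb W v. card (nb W u) = 2} \<le> 1"
        "\<And>u v. v \<in> W \<Longrightarrow> u \<in> nb W v \<Longrightarrow> card (nb W v) = 2 \<Longrightarrow> card (nb W u) \<noteq> 2"
  proof -
    assume *: "W = {} \<Longrightarrow> thesis" "\<And>v. v \<in> W \<Longrightarrow> card (nb W v) \<le> 1 \<Longrightarrow> thesis"
      "\<And>v u. v \<in> W \<Longrightarrow> u \<in> nb W v \<Longrightarrow> card (nb W u) = 2 \<Longrightarrow> card (nb W v) = 2 \<Longrightarrow> thesis"
      "\<And>v. v \<in> W \<Longrightarrow> card (nb W v) = 3 \<Longrightarrow> \<not> card {u \<in> nb W v. card (nb W u) = 2} \<le> 1 \<Longrightarrow>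
        (\<And>u v. v \<in> W \<Longrightarrow> u \<in> nb W v \<Longrightarrow> card (nb W v) = 2 \<Longrightarrow> card (nb W u) \<noteq> 2) \<Longrightarrow> thesis"
    show thesis
    proof (rule ccontr)
      assume no: "\<not> thesis"
      then have "2 \<le> card (nb W v)" if "v \<in> W" for v
        using *(2)[OF that] by linarith
      moreover have adj: "card (nb W u) \<noteq> 2" if "v \<in> W" "u \<in> nb W v" "card (nb W v) = 2" for u v
        using *(3)[OF that(1,2) _ that(3)] no by blast
      moreover have "card {u \<in> nb W v. card (nb W u) = 2} \<le> 1" if "v \<in> W" "card (nb W v) = 3" for v
        using *(4)[OF that] adj no by blast
      ultimately have "\<not> sparse 3 8 W"
        using *(1) no less.prems(1) by (intro not_sparse_8_3) auto
      then show False using less.prems(2) by simp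
    qed
  qed
  then show ?case
  proof cases
    case 1
    then have "pcf_on W 5 (\<lambda>_. 0)" by (simp add: pcf_on_def proper_on_def)
    then show ?thesis by blast
  next
    case (2 v)
    then show ?thesis using pcf_on_insert_degree_le_1[of W v 5] less.prems IH[of "{v}"] by auto
  next
    case (3 u v)
    have "u \<in> W" "v \<in> nb W u" using 3 nb_subset nb_symD by auto
    obtain u' where u': "nb W u = {u', v}" "u' \<noteq> v"
      using 3(3) \<open>v \<in> nb W u\<close> by (auto simp: card_2_iff doubleton_eq_iff)
    obtain v' where v': "nb W v = {u, v'}" "v' \<noteq> u"
      using 3(2,4) by (auto simp: card_2_iff doubleton_eq_iff)
    show ?thesis
      using pcf_on_insert_adjacent_2_vertices[OF \<open>u \<in> W\<close> 3(1) u'(1) v'(1) u'(2) v'(2)] IH[of "{u, v}"] 3(1)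
      by auto
  next
    case (4 v)
    from 4(3) have "2 \<le> card {u \<in> nb W v. card (nb W u) = 2}" by simp
    then obtain S where S: "S \<subseteq> {u \<in> nb W v. card (nb W u) = 2}" "card S = 2"
      by (meson obtain_subset_with_card_n)
    obtain a b where "S = {a, b}" "a \<noteq> b" using S(2) by (auto simp: card_2_iff)
    then have ab: "a \<in> nb W v" "b \<in> nb W v" "card (nb W a) = 2" "card (nb W b) = 2" "a \<noteq> b"
      using S(1) by auto
    have "card (nb W v - {a, b}) = 1"
      using card_Diff_subset[of "{a, b}" "nb W v"] ab 4(2) by simp
    then obtain w where "nb W v - {a, b} = {w}" by (auto simp: card_1_singleton_iff)
    then have w: "nb W v = {a, b, w}" using ab by auto
    have W: "a \<in> W" "b \<in> W" "v \<in> nb W a" "v \<in> nb W b" using ab nb_subset nb_symD 4(1) by auto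
    obtain a' where a': "nb W a = {v, a'}" "a' \<noteq> v"
      using ab(3) W(3) by (auto simp: card_2_iff doubleton_eq_iff)
    obtain b' where b': "nb W b = {v, b'}" "b' \<noteq> v"
      using ab(4) W(4) by (auto simp: card_2_iff doubleton_eq_iff)
    have "b \<notin> nb W a" "a \<notin> nb W b" using 4(4) W ab by blast+
    then have "a' \<notin> {v, b}" "b' \<notin> {v, a}" using a' b' by auto
    then show ?thesis
      using pcf_on_insert_3_vertex[OF 4(1) W(1,2) w _ a'(1) b'(1)] IH[of "{v, a, b}"] 4(1,2) w
      by auto
  qed
qed

section \<open>Pentagon cacti and their four-colourings with one movable defect\<close>

section \<open>Cacti of pentagons\<close>

text \<open>Neighbourhoods are taken in the enlarged set, so the new vertices induce a path that is
  joined to \<open>W\<close> only at \<open>x\<close>, by both its ends.\<close>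

definition pendant_pentagon :: "'a set \<Rightarrow> 'a \<Rightarrow> 'a \<Rightarrow> 'a \<Rightarrow> 'a \<Rightarrow> 'a \<Rightarrow> bool" where
  "pendant_pentagon W x p q r s \<longleftrightarrow>
    x \<in> W \<and> W \<inter> {p, q, r, s} = {} \<and> distinct [p, q, r, s] \<and>
    nb (W \<union> {p, q, r, s}) p = {x, q} \<and> nb (W \<union> {p, q, r, s}) q = {p, r} \<and>
    nb (W \<union> {p, q, r, s}) r = {q, s} \<and> nb (W \<union> {p, q, r, s}) s = {r, x}"

text \<open>The seed is not in \<open>\<F>\<close>, which demands two vertices, but it may be what
  remains after a pentagon is removed.\<close>

inductive pentagon_cactus :: "'a set \<Rightarrow> bool" where
  single: "pentagon_cactus {x}"
| pentagon: "pentagon_cactus W \<Longrightarrow> pendant_pentagon W x p q r s \<Longrightarrow> pentagon_cactus (W \<union> {p, q, r, s})"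

text \<open>Reflection halves the positions to be treated for a defect inside the pentagon.\<close>

lemma pendant_pentagon_rev:
  "pendant_pentagon W x p q r s \<Longrightarrow> pendant_pentagon W x s r q p"
  unfolding pendant_pentagon_def by (auto simp: insert_commute)

lemma nb_pendant_pentagon:
  assumes "pendant_pentagon W x p q r s"
  shows "nb (W \<union> {p, q, r, s}) x = insert p (insert s (nb W x))"
    and "z \<in> W \<Longrightarrow> z \<noteq> x \<Longrightarrow> nb (W \<union> {p, q, r, s}) z = nb W z"
proof -
  let ?V = "W \<union> {p, q, r, s}"
  have P: "x \<in> W" "W \<inter> {p, q, r, s} = {}" "nb ?V p = {x, q}" "nb ?V q = {p, r}" "nb ?V r = {q, s}" "nb ?V s = {r, x}"
    using assms unfolding pendant_pentagon_def by auto
  have nbV: "v \<in> nb ?V u \<longleftrightarrow> u \<in> nb ?V v" if "u \<in> ?V" "v \<in> ?V" for u v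
    using nb_symD that by blast
  have split: "nb ?V z = nb W z \<union> (nb ?V z \<inter> {p, q, r, s})" for z
    by (auto simp: nb_def)
  have mem: "z \<in> W \<Longrightarrow> (p \<in> nb ?V z \<longleftrightarrow> z = x) \<and> (s \<in> nb ?V z \<longleftrightarrow> z = x) \<and> q \<notin> nb ?V z \<and> r \<notin> nb ?V z" for z
    using nbV[of z p] nbV[of z q] nbV[of z r] nbV[of z s] P by auto
  show "nb ?V x = insert p (insert s (nb W x))"
    using split[of x] mem[OF P(1)] by auto
  show "nb ?V z = nb W z" if "z \<in> W" "z \<noteq> x"
    using split[of z] mem[OF that(1)] that(2) by auto
qed

text \<open>A catalogue of the local effects of colouring the new path \<open>i\<close>,
  \<open>j\<close>, \<open>l\<close>, \<open>m\<close>. Equal ends of the right colour keep a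
  monochromatic neighbourhood at \<open>x\<close>, different ends can repair it;
  \<open>j = c x\<close> creates a defect at \<open>p\<close> and \<open>i = l\<close> one at
  \<open>q\<close>.\<close>

lemma pendant_pentagon_colour:
  assumes pent: "pendant_pentagon W x p q r s" and "proper_on W k c"
    and "i < k" "j < k" "l < k" "m < k"
    and "i \<noteq> c x" "i \<noteq> j" "j \<noteq> l" "l \<noteq> m" "m \<noteq> c x"
  defines "V \<equiv> W \<union> {p, q, r, s}" and "d \<equiv> c(p := i, q := j, r := l, s := m)"
  shows "proper_on V k d"
    and "\<And>z t. z \<in> W \<Longrightarrow> z \<noteq> x \<Longrightarrow> unique_at W c z t \<Longrightarrow> unique_at V d z t"
    and "\<And>z t. z \<in> W \<Longrightarrow> z \<noteq> x \<Longrightarrow> mono_at W c z t \<Longrightarrow> mono_at V d z t"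
    and "\<And>t. unique_at W c x t \<Longrightarrow> t \<noteq> i \<Longrightarrow> t \<noteq> m \<Longrightarrow> unique_at V d x t"
    and "mono_at W c x i \<Longrightarrow> m = i \<Longrightarrow> mono_at V d x i"
    and "\<And>t. mono_at W c x t \<Longrightarrow> t \<noteq> i \<Longrightarrow> m \<noteq> i \<Longrightarrow> unique_at V d x i"
    and "c x \<noteq> j \<Longrightarrow> unique_at V d p j" "i \<noteq> l \<Longrightarrow> unique_at V d q l"
    and "j \<noteq> m \<Longrightarrow> unique_at V d r j" "c x \<noteq> l \<Longrightarrow> unique_at V d s l"
    and "j = c x \<Longrightarrow> mono_at V d p (c x)" "i = l \<Longrightarrow> mono_at V d q i"
    and "\<And>v. v \<in> W \<Longrightarrow> d v = c v" "d p = i" "d q = j" "d r = l" "d s = m"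
proof -
  have P: "x \<in> W" "W \<inter> {p, q, r, s} = {}" "distinct [p, q, r, s]"
    "nb V p = {x, q}" "nb V q = {p, r}" "nb V r = {q, s}" "nb V s = {r, x}"
    using pent unfolding pendant_pentagon_def V_def by auto
  have x: "x \<noteq> p" "x \<noteq> q" "x \<noteq> r" "x \<noteq> s" using P by auto
  show dW: "d v = c v" if "v \<in> W" for v
    using that P(2) by (auto simp: d_def)
  show d: "d p = i" "d q = j" "d r = l" "d s = m" using P(3) by (auto simp: d_def)
  have dx: "d x = c x" using dW P(1) by blast
  have nbW: "y \<in> nb W z \<Longrightarrow> d y = c y" for y z using dW nb_subset by blast
  show "proper_on V k d"
  proof (rule proper_on_extend[OF assms(2) _ dW])
    fix u assume "u \<in> V - W"
    then have u: "u = p \<or> u = q \<or> u = r \<or> u = s" by (auto simp: V_def)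
    then show "d u < k" using d assms(3-6) by auto
    fix v assume "v \<in> nb V u"
    then show "d u \<noteq> d v" using u P(4-7) d dx assms(7-11) by auto
  qed (auto simp: V_def)
  show "unique_at V d z t" if "z \<in> W" "z \<noteq> x" "unique_at W c z t" for z t
  proof -
    have "nb V z = nb W z" using nb_pendant_pentagon(2)[OF pent that(1,2)] by (simp add: V_def)
    then show ?thesis using that(3) nbW unfolding unique_at_def by auto
  qed
  show "mono_at V d z t" if "z \<in> W" "z \<noteq> x" "mono_at W c z t" for z t
  proof -
    have "nb V z = nb W z" using nb_pendant_pentagon(2)[OF pent that(1,2)] by (simp add: V_def)
    then show ?thesis using that(3) nbW unfolding mono_at_def by auto
  qed
  have nbx: "nb V x = insert p (insert s (nb W x))"
    using nb_pendant_pentagon(1)[OF pent] by (simp add: V_def)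
  show "unique_at V d x t" if "unique_at W c x t" "t \<noteq> i" "t \<noteq> m" for t
    by (rule unique_at_extend[OF that(1) _ dW]) (use that nbx d nb_subset in \<open>auto simp: V_def\<close>)
  show "mono_at V d x i" if "mono_at W c x i" "m = i"
    using that nbx d nbW unfolding mono_at_def by auto
  show "unique_at V d x i" if "mono_at W c x t" "t \<noteq> i" "m \<noteq> i" for t
    using that nbx d nbW unfolding mono_at_def unique_at_def by auto
  show "unique_at V d p j" if "c x \<noteq> j"
    using unique_at_pair[of V p q x d] P(4) that d dx by (auto simp: insert_commute)
  show "unique_at V d q l" if "i \<noteq> l"
    using unique_at_pair[of V q r p d] P(5) that d dx by (auto simp: insert_commute)
  show "unique_at V d r j" if "j \<noteq> m"
    using unique_at_pair[of V r q s d] P(6) that d dx by auto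
  show "unique_at V d s l" if "c x \<noteq> l"
    using unique_at_pair[of V s r x d] P(7) that d dx by auto
  show "mono_at V d p (c x)" if "j = c x"
    using that P(4) d dx by (auto simp: mono_at_def)
  show "mono_at V d q i" if "i = l"
    using that P(5) d dx by (auto simp: mono_at_def)
qed

lemma ex_two_further_colours:
  assumes "a \<noteq> b"
  obtains u v :: nat where "u < 4" "v < 4" "u \<notin> {a, b}" "v \<notin> {a, b}" "u \<noteq> v"
proof -
  obtain u where "u < 4" "u \<notin> set [a, b]" using ex_colour_avoiding[of "[a, b]" 4] by auto
  moreover obtain v where "v < 4" "v \<notin> set [a, b, u]" using ex_colour_avoiding[of "[a, b, u]" 4] by auto
  ultimately show thesis using that by auto
qed

text \<open>The colour \<open>i\<close> differs from \<open>c x\<close>, so it can be given to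
  further neighbours of \<open>x\<close> without changing the defect; at an isolated
  \<open>x\<close> it is simply a spare colour.\<close>

definition pcf_except :: "'a set \<Rightarrow> nat \<Rightarrow> ('a \<Rightarrow> nat) \<Rightarrow> 'a \<Rightarrow> nat \<Rightarrow> bool" where
  "pcf_except W k c x i \<longleftrightarrow> proper_on W k c \<and> (\<forall>z \<in> W - {x}. \<exists>i. unique_at W c z i) \<and>
     mono_at W c x i \<and> i < k \<and> i \<noteq> c x"

text \<open>The defect moves from \<open>x\<close> into the pentagon: the far end of the new path
  takes the old defect colour \<open>i\<close>, and the near end a different one, which becomes
  unique at \<open>x\<close>.\<close>

lemma pendant_pentagon_pcf_except_near:
  assumes pent: "pendant_pentagon W x p q r s" and "pcf_except W 4 c x i" and "y = p \<or> y = q"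
  shows "\<exists>d j. pcf_except (W \<union> {p, q, r, s}) 4 d y j"
proof -
  let ?V = "W \<union> {p, q, r, s}"
  have c: "proper_on W 4 c" "\<And>z. z \<in> W \<Longrightarrow> z \<noteq> x \<Longrightarrow> \<exists>i. unique_at W c z i" "mono_at W c x i" "i < 4" "i \<noteq> c x"
    using assms(2) unfolding pcf_except_def by auto
  have cx: "c x < 4" using c(1) pent unfolding proper_on_def pendant_pentagon_def by auto
  obtain u v where uv: "u < 4" "v < 4" "u \<notin> {i, c x}" "v \<notin> {i, c x}" "u \<noteq> v"
    using ex_two_further_colours[OF c(5)] .
  show ?thesis
    using assms(3)
  proof
    assume y: "y = p"
    have ne: "u \<noteq> c x" "u \<noteq> c x" "c x \<noteq> v" "v \<noteq> i" "i \<noteq> c x" "i \<noteq> u" "u \<noteq> v" "c x \<noteq> i"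
      using uv c(5) by auto
    \<comment> \<open>Giving \<open>q\<close> the colour of \<open>x\<close> makes the neighbourhood
      of \<open>p\<close> monochromatic.\<close>
    note col = pendant_pentagon_colour[OF pent c(1) uv(1) cx uv(2) c(4) ne(1-5)]
    have "pcf_except ?V 4 (c(p := u, q := c x, r := v, s := i)) y (c x)"
      unfolding pcf_except_def y
    proof (intro conjI ballI)
      fix z assume "z \<in> ?V - {p}"
      then consider "z \<in> W" "z \<noteq> x" | "z = x" | "z = q" | "z = r" | "z = s" by blast
      then show "\<exists>t. unique_at ?V (c(p := u, q := c x, r := v, s := i)) z t"
      proof cases
        case 1
        then obtain t where "unique_at W c z t" using c(2) by blast
        from col(2)[OF 1 this] show ?thesis by (rule exI)
      next
        case 2 then show ?thesis using col(6)[OF c(3)] ne by blast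
      next
        case 3 then show ?thesis using col(8) ne by blast
      next
        case 4 then show ?thesis using col(9) ne by blast
      next
        case 5 then show ?thesis using col(10) ne by blast
      qed
    qed (use col(1) col(11)[OF refl] col(14) ne cx in auto)
    then show ?thesis by blast
  next
    assume y: "y = q"
    have ne: "u \<noteq> c x" "u \<noteq> v" "v \<noteq> u" "u \<noteq> i" "i \<noteq> c x" "c x \<noteq> u" "i \<noteq> u" "v \<noteq> i" "c x \<noteq> v" using uv c(5) by auto
    \<comment> \<open>Equal colours on \<open>p\<close> and \<open>r\<close> put the defect at
      \<open>q\<close>.\<close>
    note col = pendant_pentagon_colour[OF pent c(1) uv(1) uv(2) uv(1) c(4) ne(1-5)]
    have "pcf_except ?V 4 (c(p := u, q := v, r := u, s := i)) y u"
      unfolding pcf_except_def y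
    proof (intro conjI ballI)
      fix z assume "z \<in> ?V - {q}"
      then consider "z \<in> W" "z \<noteq> x" | "z = x" | "z = p" | "z = r" | "z = s" by blast
      then show "\<exists>t. unique_at ?V (c(p := u, q := v, r := u, s := i)) z t"
      proof cases
        case 1
        then obtain t where "unique_at W c z t" using c(2) by blast
        from col(2)[OF 1 this] show ?thesis by (rule exI)
      next
        case 2 then show ?thesis using col(6)[OF c(3)] ne by blast
      next
        case 3 then show ?thesis using col(7) ne by blast
      next
        case 4 then show ?thesis using col(9) ne by blast
      next
        case 5 then show ?thesis using col(10) ne by blast
      qed
    qed (use col(1) col(12)[OF refl] col(15) ne uv in auto)
    then show ?thesis by blast
  qed
qed

text \<open>Both ends receive the same colour, different from \<open>t\<close>, so \<open>t\<close>
  stays unique at \<open>x\<close>; with the two middle colours chosen afresh, every new vertex sees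
  two different colours.\<close>

lemma pendant_pentagon_colour_far:
  assumes pent: "pendant_pentagon W x p q r s" and c: "proper_on W 4 c" and x: "unique_at W c x t"
  defines "V \<equiv> W \<union> {p, q, r, s}"
  obtains d where "proper_on V 4 d" "\<And>v. v \<in> W \<Longrightarrow> d v = c v"
    and "\<And>z i. z \<in> W \<Longrightarrow> unique_at W c z i \<Longrightarrow> z \<noteq> x \<Longrightarrow> unique_at V d z i"
    and "\<And>z i. z \<in> W \<Longrightarrow> z \<noteq> x \<Longrightarrow> mono_at W c z i \<Longrightarrow> mono_at V d z i"
    and "\<And>z. z \<in> insert x (V - W) \<Longrightarrow> \<exists>i. unique_at V d z i"
proof -
  have cx: "c x < 4" using c pent unfolding proper_on_def pendant_pentagon_def by auto
  obtain i where i: "i < 4" "i \<notin> set [c x, t]" using ex_colour_avoiding[of "[c x, t]" 4] by auto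
  then have "i \<noteq> c x" by auto
  obtain u v where uv: "u < 4" "v < 4" "u \<notin> {i, c x}" "v \<notin> {i, c x}" "u \<noteq> v"
    using ex_two_further_colours[OF \<open>i \<noteq> c x\<close>] .
  let ?d = "c(p := i, q := u, r := v, s := i)"
  have neq: "i \<noteq> c x" "i \<noteq> u" "u \<noteq> v" "v \<noteq> i" "i \<noteq> c x" using i uv by auto
  note col = pendant_pentagon_colour[OF pent c i(1) uv(1,2) i(1) neq, folded V_def]
  show thesis
  proof (rule that[of ?d])
    fix z assume "z \<in> insert x (V - W)"
    then consider "z = x" | "z = p" | "z = q" | "z = r" | "z = s" by (auto simp: V_def)
    then show "\<exists>t. unique_at V ?d z t"
    proof cases
      case 1 then show ?thesis using col(4)[OF x] i by force
    next
      case 2 then show ?thesis using col(7) uv by force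
    next
      case 3 then show ?thesis using col(8) uv by force
    next
      case 4 then show ?thesis using col(9) uv by force
    next
      case 5 then show ?thesis using col(10) uv by force
    qed
  qed (use col(1-3,13) in auto)
qed

text \<open>The freedom to prescribe \<open>y\<close> drives the induction: the hypothesis is used
  at \<open>x\<close> if \<open>y\<close> lies on the last pentagon, and at \<open>y\<close> itself
  otherwise.\<close>

lemma pentagon_cactus_pcf_except:
  assumes "pentagon_cactus W" "y \<in> W"
  shows "\<exists>c i. pcf_except W 4 c y i"
  using assms
proof (induction arbitrary: y rule: pentagon_cactus.induct)
  case (single x)
  then have "pcf_except {x} 4 (\<lambda>_. 0) y 1"
    by (auto simp: pcf_except_def proper_on_def mono_at_def nb_def E_irrefl)
  then show ?case by blast
next
  case (pentagon W x p q r s)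
  let ?V = "W \<union> {p, q, r, s}"
  have x: "x \<in> W" using pentagon.hyps unfolding pendant_pentagon_def by blast
  obtain c i where c: "pcf_except W 4 c x i" using pentagon.IH[OF x] by blast
  consider "y = x" | "y \<in> W" "y \<noteq> x" | "y = p \<or> y = q" | "y = s \<or> y = r"
    using pentagon.prems by blast
  then show ?case
  proof cases
    case 1
    have cd: "proper_on W 4 c" "\<And>z. z \<in> W \<Longrightarrow> z \<noteq> x \<Longrightarrow> \<exists>i. unique_at W c z i" "mono_at W c x i" "i < 4" "i \<noteq> c x"
      using c unfolding pcf_except_def by auto
    obtain u v where uv: "u < 4" "v < 4" "u \<notin> {i, c x}" "v \<notin> {i, c x}" "u \<noteq> v"
      using ex_two_further_colours[OF cd(5)] .
    \<comment> \<open>Both ends take the colour of the existing defect, so the neighbourhood of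
      \<open>x\<close> stays monochromatic.\<close>
    let ?d = "c(p := i, q := u, r := v, s := i)"
    have neq: "i \<noteq> c x" "i \<noteq> u" "u \<noteq> v" "v \<noteq> i" "i \<noteq> c x" using cd uv by auto
    note col = pendant_pentagon_colour[OF pentagon.hyps(2) cd(1) cd(4) uv(1,2) cd(4) neq]
    have "pcf_except ?V 4 ?d x i"
      unfolding pcf_except_def
    proof (intro conjI ballI)
      fix z assume "z \<in> ?V - {x}"
      then consider "z \<in> W" "z \<noteq> x" | "z = p" | "z = q" | "z = r" | "z = s" by blast
      then show "\<exists>t. unique_at ?V ?d z t"
      proof cases
        case 1
        then obtain t where "unique_at W c z t" using cd(2) by blast
        from col(2)[OF 1 this] show ?thesis by (rule exI)
      next
        case 2 then show ?thesis using col(7) uv by force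
      next
        case 3 then show ?thesis using col(8) uv by force
      next
        case 4 then show ?thesis using col(9) uv by force
      next
        case 5 then show ?thesis using col(10) uv by force
      qed
    next
      show "i \<noteq> ?d x" using col(13)[OF x] cd(5) by simp
    qed (use col(1,5) cd in auto)
    then show ?thesis using 1 by blast
  next
    case 2
    obtain c i where cd: "pcf_except W 4 c y i" using pentagon.IH[OF 2(1)] by blast
    \<comment> \<open>With the defect at \<open>y\<close>, some colour is unique at
      \<open>x\<close>, and the pentagon can be added without disturbing \<open>y\<close>.\<close>
    then obtain t where t: "unique_at W c x t" using 2 x unfolding pcf_except_def by blast
    have c4: "proper_on W 4 c" using cd unfolding pcf_except_def by blast
    obtain d where d: "proper_on ?V 4 d" "\<And>v. v \<in> W \<Longrightarrow> d v = c v"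
      "\<And>z i. z \<in> W \<Longrightarrow> unique_at W c z i \<Longrightarrow> z \<noteq> x \<Longrightarrow> unique_at ?V d z i"
      "\<And>z i. z \<in> W \<Longrightarrow> z \<noteq> x \<Longrightarrow> mono_at W c z i \<Longrightarrow> mono_at ?V d z i"
      "\<And>z. z \<in> insert x (?V - W) \<Longrightarrow> \<exists>i. unique_at ?V d z i"
      using pendant_pentagon_colour_far[OF pentagon.hyps(2) c4 t] by blast
    have "pcf_except ?V 4 d y i"
      unfolding pcf_except_def
    proof (intro conjI ballI)
      fix z assume z: "z \<in> ?V - {y}"
      show "\<exists>i. unique_at ?V d z i"
      proof (cases "z \<in> W \<and> z \<noteq> x")
        case True
        then show ?thesis using z d(3) cd unfolding pcf_except_def by blast
      next
        case False
        then show ?thesis using z d(5)[of z] by blast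
      qed
    qed (use d(1) d(2)[OF 2(1)] d(4)[OF 2] cd in \<open>auto simp: pcf_except_def\<close>)
    then show ?thesis by blast
  next
    case 3
    show ?thesis by (rule pendant_pentagon_pcf_except_near[OF pentagon.hyps(2) c 3])
  next
    case 4
    have "?V = W \<union> {s, r, q, p}" by auto
    then show ?thesis
      using pendant_pentagon_pcf_except_near[OF pendant_pentagon_rev[OF pentagon.hyps(2)] c 4] by simp
  qed
qed

section \<open>Connectivity by cuts, and what remains after deleting an attached set\<close>

section \<open>Connectivity\<close>

text \<open>Connectivity is expressed by cuts because the arguments below compare sets closed under
  adjacency and never follow walks. The empty set counts as connected.\<close>

definition connected_on :: "'a set \<Rightarrow> bool" where
  "connected_on W \<longleftrightarrow> (\<forall>A \<subseteq> W. A \<noteq> {} \<longrightarrow> A \<noteq> W \<longrightarrow> (\<exists>x \<in> A. \<exists>y \<in> W - A. (x, y) \<in> E))"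

lemma connected_on_nb_nonempty:
  assumes "connected_on W" "x \<in> W" "W \<noteq> {x}"
  shows "nb W x \<noteq> {}"
  using assms unfolding connected_on_def nb_def by blast

lemma connected_on_closed:
  assumes "connected_on W" "A \<subseteq> W" "A \<noteq> {}" "\<And>x. x \<in> A \<Longrightarrow> nb W x \<subseteq> A"
  shows "A = W"
  using assms unfolding connected_on_def nb_def by blast

text \<open>The set \<open>P\<close> is attached to the rest only at \<open>x\<close>, so a part
  that avoids \<open>x\<close> and is closed in \<open>W - P\<close> would be closed in
  \<open>W\<close>.\<close>

lemma connected_on_Diff:
  assumes "connected_on W" "\<And>p. p \<in> P \<Longrightarrow> nb W p \<subseteq> insert x P"
  shows "connected_on (W - P)"
  unfolding connected_on_def
proof (intro allI impI)
  fix A assume A: "A \<subseteq> W - P" "A \<noteq> {}" "A \<noteq> W - P"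
  have cross: "\<exists>u \<in> B. \<exists>v \<in> W - P - B. (u, v) \<in> E" if "B \<subseteq> W - P" "B \<noteq> {}" "x \<notin> B" "B \<noteq> W - P" for B
  proof (rule ccontr)
    assume no: "\<not> ?thesis"
    have "nb W u \<subseteq> B" if u: "u \<in> B" for u
    proof
      fix v assume v: "v \<in> nb W u"
      have "v \<notin> P"
      proof
        assume "v \<in> P"
        moreover have "u \<in> nb W v" using nb_symD[OF v] u \<open>B \<subseteq> W - P\<close> by blast
        ultimately show False using assms(2)[of v] u \<open>x \<notin> B\<close> \<open>B \<subseteq> W - P\<close> by blast
      qed
      then show "v \<in> B" using no u v by (auto simp: nb_def)
    qed
    then have "B = W" using connected_on_closed[OF assms(1)] that by blast
    then show False using that by blast
  qed
  show "\<exists>u \<in> A. \<exists>v \<in> W - P - A. (u, v) \<in> E"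
  proof (cases "x \<in> A")
    case False
    then show ?thesis using cross A by blast
  next
    case True
    \<comment> \<open>Here the complement of \<open>A\<close> avoids \<open>x\<close>, and the
      crossing edge found from it is reversed.\<close>
    then have "\<exists>u \<in> W - P - A. \<exists>v \<in> W - P - (W - P - A). (u, v) \<in> E"
      using A by (intro cross) auto
    then show ?thesis using E_sym by blast
  qed
qed

text \<open>Every part closed in \<open>W - P\<close> contains \<open>x\<close> or \<open>y\<close>,
  the only possible places where \<open>P\<close> is attached. Hence there are just two components,
  one for each.\<close>

lemma not_connected_on_Diff:
  assumes "connected_on W" "\<And>p. p \<in> P \<Longrightarrow> nb W p \<subseteq> insert x (insert y P)" "x \<in> W - P"
    and "\<not> connected_on (W - P)"
  obtains A B where "A \<union> B = W - P" "A \<inter> B = {}" "x \<in> A" "y \<in> B" "connected_on A" "connected_on B"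
    "\<And>u v. u \<in> A \<Longrightarrow> v \<in> B \<Longrightarrow> (u, v) \<notin> E"
proof -
  let ?U = "W - P"
  define closed where "closed S \<longleftrightarrow> S \<subseteq> ?U \<and> S \<noteq> {} \<and> (\<forall>u \<in> S. \<forall>v \<in> ?U - S. (u, v) \<notin> E)" for S
  have meets: "x \<in> S \<or> y \<in> S" if S: "closed S" for S
  proof (rule ccontr)
    assume no: "\<not> ?thesis"
    have "nb W u \<subseteq> S" if u: "u \<in> S" for u
    proof
      fix v assume v: "v \<in> nb W u"
      have "v \<notin> P"
      proof
        assume "v \<in> P"
        moreover have "u \<in> nb W v" using nb_symD[OF v] u S by (auto simp: closed_def)
        ultimately show False using assms(2)[of v] u no S unfolding closed_def by blast
      qed
      then show "v \<in> S" using S u v by (auto simp: closed_def nb_def)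
    qed
    then have "S = W" using connected_on_closed[OF assms(1)] S by (auto simp: closed_def)
    then show False using no assms(3) by blast
  qed
  \<comment> \<open>A disconnected closed part would split into two disjoint closed ones. This
    cannot happen on the side of \<open>x\<close>, where every closed part contains
    \<open>x\<close>, nor on the side of \<open>y\<close>.\<close>
  have sub_connected: "connected_on S"
    if S: "closed S" and one: "\<And>C D. C \<subseteq> S \<Longrightarrow> D \<subseteq> S \<Longrightarrow> closed C \<Longrightarrow> closed D \<Longrightarrow> C \<inter> D \<noteq> {}" for S
    unfolding connected_on_def
  proof (intro allI impI, rule ccontr)
    fix C assume C: "C \<subseteq> S" "C \<noteq> {}" "C \<noteq> S" "\<not> (\<exists>u \<in> C. \<exists>v \<in> S - C. (u, v) \<in> E)"
    then have "closed C" "closed (S - C)"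
      using S E_sym unfolding closed_def by blast+
    then show False using one[of C "S - C"] C by blast
  qed
  obtain S where S: "S \<subseteq> ?U" "S \<noteq> {}" "S \<noteq> ?U" "\<And>u v. u \<in> S \<Longrightarrow> v \<in> ?U - S \<Longrightarrow> (u, v) \<notin> E"
    using assms(4) unfolding connected_on_def by blast
  then have cl: "closed S" "closed (?U - S)" using E_sym unfolding closed_def by blast+
  define A where "A = (if x \<in> S then S else ?U - S)"
  define B where "B = ?U - A"
  have AB: "closed A" "closed B" "x \<in> A" "A \<subseteq> ?U"
    using cl S assms(3) by (auto simp: A_def B_def double_diff)
  have y: "y \<in> B" using meets[OF AB(2)] AB(3) by (auto simp: B_def)
  show thesis
  proof (rule that[of A B])
    show "connected_on A"
    proof (rule sub_connected[OF AB(1)])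
      fix C D assume "C \<subseteq> A" "D \<subseteq> A" "closed C" "closed D"
      then show "C \<inter> D \<noteq> {}" using meets[of C] meets[of D] y unfolding B_def by blast
    qed
    show "connected_on B"
    proof (rule sub_connected[OF AB(2)])
      fix C D assume "C \<subseteq> B" "D \<subseteq> B" "closed C" "closed D"
      then show "C \<inter> D \<noteq> {}" using meets[of C] meets[of D] AB(3) unfolding B_def by blast
    qed
  qed (use AB y in \<open>auto simp: B_def closed_def\<close>)
qed

section \<open>Counting arcs at 24/11, inserting paths, and the induction for four colours\<close>

section \<open>Four colours\<close>

lemma card_arcs:
  assumes "finite S" "S \<subseteq> W" "finite W"
  shows "card (SIGMA v:S. nb W v) = (\<Sum>v\<in>S. card (nb W v))"
  using assms finite_nb by (simp add: card_SigmaI)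

text \<open>Going backwards from an arc whose tail has degree 2, one meets a tail of degree at least
  3 within three steps, since four such tails in a row are excluded. Each step back is injective, so
  the arcs of the first kind are at most three times as many as those of the second.\<close>

lemma not_sparse_24_11:
  assumes fin: "finite W" and "W \<noteq> {}"
    and deg: "\<And>v. v \<in> W \<Longrightarrow> 2 \<le> card (nb W v)"
    and no_path: "\<And>p q r s. {p, q, r, s} \<subseteq> W \<Longrightarrow> q \<in> nb W p \<Longrightarrow> r \<in> nb W q \<Longrightarrow> s \<in> nb W r \<Longrightarrow>
      p \<noteq> r \<Longrightarrow> q \<noteq> s \<Longrightarrow> \<forall>v \<in> {p, q, r, s}. card (nb W v) = 2 \<Longrightarrow> False"
  shows "\<not> sparse 11 24 W"
proof -
  define S where "S = {v \<in> W. card (nb W v) = 2}"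
  define L where "L = W - S"
  define A2 where "A2 = (SIGMA v:S. nb W v)"
  define A3 where "A3 = (SIGMA v:L. nb W v)"
  have sub: "S \<subseteq> W" "L \<subseteq> W" "finite S" "finite L" using fin by (auto simp: S_def L_def)
  have finA: "finite A2" "finite A3" using sub fin finite_nb by (auto simp: A2_def A3_def)
  have "\<exists>u. nb W v = {u, w} \<and> u \<noteq> w" if "(v, w) \<in> A2" for v w
    using that by (auto simp: A2_def S_def card_2_iff)
  then obtain oth where oth: "\<And>v w. (v, w) \<in> A2 \<Longrightarrow> nb W v = {oth v w, w} \<and> oth v w \<noteq> w"
    by metis
  \<comment> \<open>The preceding arc on a walk without turning back: it enters the tail of
    \<open>a\<close> from the other neighbour of that tail.\<close>
  define pred where "pred a = (oth (fst a) (snd a), fst a)" for a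
  have pred_in: "pred a \<in> A2 \<union> A3" if "a \<in> A2" for a
  proof -
    obtain v w where a: "a = (v, w)" by (cases a)
    then have "v \<in> W" "nb W v = {oth v w, w}" using that oth[of v w] sub(1) by (auto simp: A2_def)
    then have "oth v w \<in> W" "v \<in> nb W (oth v w)"
      using nb_subset[of W v] nb_symD[of "oth v w" W v] by auto
    then show ?thesis by (auto simp: a pred_def A2_def A3_def L_def)
  qed
  have inj: "inj_on pred A2"
  proof (rule inj_onI)
    fix a b assume ab: "a \<in> A2" "b \<in> A2" "pred a = pred b"
    obtain v w where a: "a = (v, w)" by (cases a)
    obtain v' w' where b: "b = (v', w')" by (cases b)
    have v: "v' = v" "oth v w = oth v w'" using ab(3) by (auto simp: a b pred_def)
    have 1: "nb W v = {oth v w, w}" "oth v w \<noteq> w" using oth[of v w] ab(1) by (auto simp: a)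
    have 2: "nb W v = {oth v w', w'}" "oth v w' \<noteq> w'" using oth[of v w'] ab(2) v(1) by (auto simp: b)
    have "w \<in> {oth v w', w'}" using 1(1) 2(1) by blast
    then have "w = w'" using v(2) 1(2) by auto
    then show "a = b" using v(1) by (simp add: a b)
  qed
  define lev where "lev X = {a \<in> A2. pred a \<in> X}" for X
  have lev_le: "card (lev X) \<le> card X" if "finite X" for X
    using inj that by (intro card_inj_on_le[of pred]) (auto simp: lev_def intro: inj_on_subset)
  have fin_lev: "finite (lev X)" for X using finA by (simp add: lev_def)
  \<comment> \<open>Staying in \<open>A2\<close> for three steps back would produce four consecutive
    tails of degree 2.\<close>
  have "A2 \<subseteq> lev A3 \<union> (lev (lev A3) \<union> lev (lev (lev A3)))"
  proof (rule subsetI, rule ccontr)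
    fix a assume a: "a \<in> A2" and "a \<notin> lev A3 \<union> (lev (lev A3) \<union> lev (lev (lev A3)))"
    then have "pred a \<in> A2" "pred (pred a) \<in> A2" "pred (pred (pred a)) \<in> A2"
      using pred_in[of a] pred_in[of "pred a"] pred_in[of "pred (pred a)"] by (auto simp: lev_def)
    moreover obtain v1 w where v1: "a = (v1, w)" by (cases a)
    moreover define v2 where "v2 = oth v1 w"
    moreover define v3 where "v3 = oth v2 v1"
    moreover define v4 where "v4 = oth v3 v2"
    ultimately have A: "(v1, w) \<in> A2" "(v2, v1) \<in> A2" "(v3, v2) \<in> A2" "(v4, v3) \<in> A2"
      using a by (auto simp: pred_def)
    have "v3 \<noteq> v1" "v4 \<noteq> v2" using oth[OF A(2)] oth[OF A(3)] by (auto simp: v3_def v4_def)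
    then show False
      using no_path[of v4 v3 v2 v1] A by (auto simp: A2_def S_def)
  qed
  then have "card A2 \<le> card (lev A3 \<union> (lev (lev A3) \<union> lev (lev (lev A3))))"
    using fin_lev by (intro card_mono) auto
  also have "\<dots> \<le> card (lev A3) + (card (lev (lev A3)) + card (lev (lev (lev A3))))"
    by (rule order.trans[OF card_Un_le]) (simp add: card_Un_le)
  also have "\<dots> \<le> 3 * card A3"
    using lev_le[OF finA(2)] lev_le[OF fin_lev, of A3] lev_le[OF fin_lev, of "lev A3"] by linarith
  finally have A23: "card A2 \<le> 3 * card A3" .
  have cA2: "card A2 = 2 * card S"
    using card_arcs[OF sub(3,1) fin] by (simp add: A2_def S_def)
  have cA3: "card A3 = (\<Sum>v\<in>L. card (nb W v))"
    using card_arcs[OF sub(4,2) fin] by (simp add: A3_def)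
  have "(\<Sum>v\<in>L. 3) \<le> (\<Sum>v\<in>L. card (nb W v))"
  proof (rule sum_mono)
    fix v assume "v \<in> L"
    then show "3 \<le> card (nb W v)" using deg[of v] by (auto simp: L_def S_def)
  qed
  then have L3: "3 * card L \<le> card A3" by (simp add: cA3)
  have disj: "W = S \<union> L" "S \<inter> L = {}" using sub by (auto simp: L_def)
  have "(\<Sum>v\<in>W. card (nb W v)) = (\<Sum>v\<in>S. card (nb W v)) + (\<Sum>v\<in>L. card (nb W v))"
    by (subst disj(1), rule sum.union_disjoint) (use sub disj in auto)
  also have "\<dots> = card A2 + card A3"
    using card_arcs[OF sub(3,1) fin] by (simp add: A2_def cA3)
  finally have "(\<Sum>v\<in>W. card (nb W v)) = card A2 + card A3" .
  moreover have "card W = card S + card L"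
    by (subst disj(1), rule card_Un_disjoint) (use sub disj in auto)
  \<comment> \<open>Here \<open>24 * card S\<close> equals \<open>12 * card A2\<close> and
    \<open>24 * card L\<close> is at most \<open>8 * card A3\<close>; the surplus
    \<open>card A2\<close> is paid for by \<open>3 * card A3\<close>.\<close>
  ultimately have "24 * card W \<le> 11 * (\<Sum>v\<in>W. card (nb W v))"
    using A23 cA2 L3 by linarith
  then show ?thesis using assms(2) unfolding sparse_def by (meson leD subset_refl)
qed

text \<open>In the application \<open>s\<close> and \<open>t\<close> are the colours of the outer
  neighbours of a four-vertex path, and \<open>i\<close> and \<open>j\<close> the colours that its
  two ends must not bring to them. The conditions at distance two make every path vertex see two
  colours.\<close>

lemma ex_path_colours:
  assumes "s < 4" "t < 4" "i < 4" "j < (4::nat)"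
  shows "\<exists>a b c d. a < 4 \<and> b < 4 \<and> c < 4 \<and> d < 4 \<and> a \<notin> {s, i, b, c} \<and> b \<notin> {s, c, d} \<and>
    c \<notin> {d, t} \<and> d \<notin> {t, j}"
proof (cases "\<exists>a<4. a \<notin> {s, i, t, j}")
  case True
  \<comment> \<open>A colour that clears all four constraints is used at both ends of the
    path.\<close>
  then obtain a where a: "a < 4" "a \<notin> {s, i, t, j}" by blast
  obtain b where b: "b < 4" "b \<notin> set [s, a]" using ex_colour_avoiding[of "[s, a]" 4] by auto
  obtain c where c: "c < 4" "c \<notin> set [t, a, b]" using ex_colour_avoiding[of "[t, a, b]" 4] by auto
  show ?thesis
    by (rule exI[of _ a], rule exI[of _ b], rule exI[of _ c], rule exI[of _ a]) (use a b c in auto)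
next
  case False
  \<comment> \<open>Otherwise the four given colours are distinct and exhaust the palette; the path
    is then coloured \<open>j\<close>, \<open>t\<close>, \<open>s\<close>, \<open>i\<close>.\<close>
  then have "{..<4} \<subseteq> set [s, i, t, j]" by auto
  then have "4 \<le> card (set [s, i, t, j])" using card_mono[of "set [s, i, t, j]" "{..<4::nat}"] by simp
  then have "distinct [s, i, t, j]" by (intro card_distinct) (use card_length[of "[s, i, t, j]"] in simp)
  then show ?thesis
    using assms by (intro exI[of _ j] exI[of _ t] exI[of _ s] exI[of _ i]) auto
qed

text \<open>At the vertices of \<open>X\<close> one further neighbour may be added, provided its colour is not the
  reserved colour \<open>i\<close>.\<close>

definition pcf_reserved :: "'a set \<Rightarrow> nat \<Rightarrow> 'a set \<Rightarrow> ('a \<Rightarrow> nat) \<Rightarrow> bool" where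
  "pcf_reserved W k X c \<longleftrightarrow> proper_on W k c \<and>
     (\<forall>z \<in> W. (\<exists>i<k. unique_at W c z i) \<or> (z \<in> X \<and> (\<exists>i<k. mono_at W c z i)))"

text \<open>Each of \<open>x\<close> and \<open>y\<close> gains one new neighbour. Avoiding the
  colour recorded there serves both cases: it preserves a unique colour and it breaks a
  monochromatic neighbourhood.\<close>

lemma pcf_on_insert_path:
  assumes P: "{p, q, r, s} \<subseteq> W" "distinct [p, q, r, s]"
    and nbs: "nb W p = {x, q}" "nb W q = {p, r}" "nb W r = {q, s}" "nb W s = {r, y}"
    and xy: "x \<in> W - {p, q, r, s}" "y \<in> W - {p, q, r, s}" "x \<noteq> y"
  defines "U \<equiv> W - {p, q, r, s}"
  assumes "pcf_reserved U 4 {x, y} c"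
  shows "\<exists>c. pcf_on W 4 c"
proof -
  have c: "proper_on U 4 c"
    and cf: "\<And>z. z \<in> U \<Longrightarrow> (\<exists>i<4. unique_at U c z i) \<or> (z \<in> {x, y} \<and> (\<exists>i<4. mono_at U c z i))"
    using assms(11) unfolding pcf_reserved_def by simp_all
  have xU: "x \<in> U" "y \<in> U" using xy by (auto simp: U_def)
  then have lt: "c x < 4" "c y < 4" using c by (auto simp: proper_on_def)
  obtain i where i: "i < 4" "unique_at U c x i \<or> mono_at U c x i" using cf[OF xU(1)] by blast
  obtain j where j: "j < 4" "unique_at U c y j \<or> mono_at U c y j" using cf[OF xU(2)] by blast
  obtain a b e d where col: "a < 4" "b < 4" "e < 4" "d < 4"
    "a \<notin> {c x, i, b, e}" "b \<notin> {c x, e, d}" "e \<notin> {d, c y}" "d \<notin> {c y, j}"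
    using ex_path_colours[OF lt i(1) j(1)] by blast
  define g where "g = c(p := a, q := b, r := e, s := d)"
  have gv: "g p = a" "g q = b" "g r = e" "g s = d" using P(2) by (auto simp: g_def)
  have gU: "g v = c v" if "v \<in> U" for v using that by (auto simp: U_def g_def)
  have gxy: "g x = c x" "g y = c y" using gU xU by auto
  have new: "v \<in> nb W z - U \<longleftrightarrow> v \<in> {p, q, r, s} \<and> z \<in> nb W v" if "z \<in> U" for v z
    using that P(1) nb_symD[of v W z] nb_symD[of z W v] nb_subset[of W z] by (auto simp: U_def)
  have rev_nb: "v \<in> {p, q, r, s} \<Longrightarrow> z \<in> nb W v \<longleftrightarrow> (v = p \<and> z = x) \<or> (v = s \<and> z = y)"
    if "z \<in> U" for v z
    using that nbs P(2) by (auto simp: U_def)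
  have out: "nb W z - U = {v. (v = p \<and> z = x) \<or> (v = s \<and> z = y)}" if z: "z \<in> U" for z
  proof (rule set_eqI)
    fix v
    show "v \<in> nb W z - U \<longleftrightarrow> v \<in> {v. (v = p \<and> z = x) \<or> (v = s \<and> z = y)}"
      unfolding new[OF z] using rev_nb[OF z, of v] by fast
  qed
  have nbx: "nb W x - U = {p}" using out[OF xU(1)] xy(3) by simp
  have nby: "nb W y - U = {s}" using out[OF xU(2)] xy(3) by simp
  have nbz: "nb W z - U = {}" if "z \<in> U" "z \<noteq> x" "z \<noteq> y" for z
    using out[OF that(1)] that(2,3) by simp
  have "pcf_on W 4 g"
  proof (rule pcf_on_extend[OF c _ gU])
    fix z assume z: "z \<in> W - U"
    then have z': "z = p \<or> z = q \<or> z = r \<or> z = s" by (auto simp: U_def)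
    then show "g z < 4" using gv col by auto
    show "g z \<noteq> g v" if "v \<in> nb W z" for v
      using that z' nbs gv gxy col by auto
    have "unique_at W g p (g x)" by (rule unique_at_pair[OF nbs(1)]) (use gv gxy col in auto)
    moreover have "unique_at W g q (g p)" by (rule unique_at_pair[OF nbs(2)]) (use gv col in auto)
    moreover have "unique_at W g r (g q)" by (rule unique_at_pair[OF nbs(3)]) (use gv col in auto)
    moreover have "unique_at W g s (g r)" by (rule unique_at_pair[OF nbs(4)]) (use gv gxy col in auto)
    ultimately show "\<exists>t. unique_at W g z t" using z' by blast
  next
    fix z assume z: "z \<in> U"
    consider "z = x" | "z = y" | "z \<noteq> x" "z \<noteq> y" by blast
    then show "inj_on g (nb W z) \<or> (\<exists>i. unique_at U c z i \<and> (\<forall>p \<in> nb W z - U. g p \<noteq> i)) \<or>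
      (\<exists>i p. mono_at U c z i \<and> nb W z - U = {p} \<and> g p \<noteq> i)"
    proof cases
      case 1
      then show ?thesis using i(2) nbx gv col by auto
    next
      case 2
      then show ?thesis using j(2) nby gv col by auto
    next
      case 3
      then show ?thesis using cf[OF z] nbz[OF z 3] by auto
    qed
  qed (auto simp: U_def)
  then show ?thesis by blast
qed

text \<open>This merges the two outcomes of the induction: a cactus is coloured with its defect at
  \<open>x\<close>, and a single vertex counts as monochromatic.\<close>

lemma pcf_or_cactus_reserved:
  assumes "connected_on W" "x \<in> W" "pentagon_cactus W \<or> (\<exists>c. pcf_on W 4 c)"
  shows "\<exists>c. pcf_reserved W 4 {x} c"
proof -
  have less: "i < 4" if "unique_at W c z i" "proper_on W 4 c" for c z i
    using that nb_subset unfolding unique_at_def proper_on_def by blast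
  show ?thesis
    using assms(3)
  proof
    assume "pentagon_cactus W"
    then obtain c i where c: "pcf_except W 4 c x i" using pentagon_cactus_pcf_except assms(2) by blast
    then have p: "proper_on W 4 c" by (simp add: pcf_except_def)
    have "(\<exists>i<4. unique_at W c z i) \<or> (z = x \<and> (\<exists>i<4. mono_at W c z i))" if z: "z \<in> W" for z
    proof (cases "z = x")
      case True
      then show ?thesis using c by (auto simp: pcf_except_def)
    next
      case False
      then obtain t where "unique_at W c z t" using c z by (auto simp: pcf_except_def)
      then show ?thesis using less[OF _ p] by blast
    qed
    then have "pcf_reserved W 4 {x} c" using p by (simp add: pcf_reserved_def)
    then show ?thesis by blast
  next
    assume "\<exists>c. pcf_on W 4 c"
    then obtain c where c: "proper_on W 4 c" "\<And>z. z \<in> W \<Longrightarrow> nb W z \<noteq> {} \<Longrightarrow> \<exists>i. unique_at W c z i"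
      unfolding pcf_on_def by blast
    have "(\<exists>i<4. unique_at W c z i) \<or> (z = x \<and> (\<exists>i<4. mono_at W c z i))" if z: "z \<in> W" for z
    proof (cases "nb W z = {}")
      case True
      \<comment> \<open>By connectivity an isolated vertex is the whole set, hence it is
        \<open>x\<close>.\<close>
      then have "W = {z}" using connected_on_nb_nonempty[OF assms(1) z] by blast
      moreover have "mono_at W c z 0" using True by (simp add: mono_at_def)
      ultimately show ?thesis using assms(2) by auto
    next
      case False
      then show ?thesis using c(2)[OF z] less[OF _ c(1)] by blast
    qed
    then have "pcf_reserved W 4 {x} c" using c(1) by (simp add: pcf_reserved_def)
    then show ?thesis by blast
  qed
qed

lemma inj_pcf_on:
  assumes "inj_on c W" "\<And>v. v \<in> W \<Longrightarrow> c v < k"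
  shows "pcf_on W k c"
proof -
  have "c u \<noteq> c v" if "u \<in> W" "v \<in> nb W u" for u v
    using that assms(1) nb_subset[of W u] not_in_nb[of u W] by (metis inj_onD subsetD)
  moreover have "inj_on c (nb W x)" for x using assms(1) nb_subset by (rule inj_on_subset)
  ultimately show ?thesis
    using assms(2) unique_at_inj unfolding pcf_on_def proper_on_def by blast
qed

lemma card_le_imp_pcf_on:
  assumes "finite W" "card W \<le> k"
  shows "\<exists>c. pcf_on W k c"
proof -
  obtain c where "bij_betw c W {0..<card W}" using ex_bij_betw_finite_nat[OF assms(1)] by blast
  then have "inj_on c W" "\<And>v. v \<in> W \<Longrightarrow> c v < card W"
    by (auto simp: bij_betw_def)
  then show ?thesis using inj_pcf_on[of c W k] assms(2) by fastforce
qed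

text \<open>Connectivity makes the path the whole graph, and at most four vertices can receive
  pairwise different colours.\<close>

lemma closed_path_pcf_4:
  assumes "finite W" "connected_on W" "{p, q, r, s} \<subseteq> W"
    and "\<And>v. v \<in> {p, q, r, s} \<Longrightarrow> nb W v \<subseteq> {p, q, r, s}"
  shows "\<exists>c. pcf_on W 4 c"
proof -
  have "W = {p, q, r, s}" using connected_on_closed[OF assms(2,3)] assms(4) by blast
  then have "card W \<le> 4" using card_length[of "[p, q, r, s]"] by simp
  then show ?thesis using card_le_imp_pcf_on[OF assms(1)] by blast
qed

lemma unique_at_cong:
  assumes "nb V z = nb U z" "\<And>v. v \<in> U \<Longrightarrow> d v = c v"
  shows "unique_at V d z i = unique_at U c z i"
proof -
  have "\<And>y. y \<in> nb U z \<Longrightarrow> d y = c y" using assms(2) nb_subset by blast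
  then show ?thesis unfolding unique_at_def assms(1) by auto
qed

lemma mono_at_cong:
  assumes "nb V z = nb U z" "\<And>v. v \<in> U \<Longrightarrow> d v = c v"
  shows "mono_at V d z i = mono_at U c z i"
proof -
  have "\<And>y. y \<in> nb U z \<Longrightarrow> d y = c y" using assms(2) nb_subset by blast
  then show ?thesis unfolding mono_at_def assms(1) by auto
qed

lemma pcf_reserved_proper: "pcf_reserved W k X c \<Longrightarrow> proper_on W k c"
  by (simp add: pcf_reserved_def)

lemma pcf_reservedE:
  assumes "pcf_reserved W k X c" "z \<in> W"
  obtains i where "i < k" "unique_at W c z i" | i where "z \<in> X" "i < k" "mono_at W c z i"
  using assms unfolding pcf_reserved_def by blast

lemma pcf_reserved_disjoint_Un:
  assumes "pcf_reserved A k X c1" "pcf_reserved B k Y c2" "A \<inter> B = {}"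
    and "\<And>u v. u \<in> A \<Longrightarrow> v \<in> B \<Longrightarrow> (u, v) \<notin> E"
  shows "\<exists>c. pcf_reserved (A \<union> B) k (X \<union> Y) c"
proof -
  let ?U = "A \<union> B"
  have nbA: "nb ?U z = nb A z" if "z \<in> A" for z
    using assms(4)[OF that] by (auto simp: nb_def)
  have nbB: "nb ?U z = nb B z" if "z \<in> B" for z
    using assms(4)[OF _ that] E_sym[of z] by (auto simp: nb_def)
  define c where "c v = (if v \<in> A then c1 v else c2 v)" for v
  have cA: "c v = c1 v" if "v \<in> A" for v using that by (simp add: c_def)
  have cB: "c v = c2 v" if "v \<in> B" for v using that assms(3) by (auto simp: c_def)
  have uA: "unique_at ?U c z i = unique_at A c1 z i" "mono_at ?U c z i = mono_at A c1 z i" if "z \<in> A" for z i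
    using unique_at_cong[OF nbA[OF that] cA] mono_at_cong[OF nbA[OF that] cA] by simp_all
  have uB: "unique_at ?U c z i = unique_at B c2 z i" "mono_at ?U c z i = mono_at B c2 z i" if "z \<in> B" for z i
    using unique_at_cong[OF nbB[OF that] cB] mono_at_cong[OF nbB[OF that] cB] by simp_all
  note proper = pcf_reserved_proper[OF assms(1)] pcf_reserved_proper[OF assms(2)]
  have "proper_on ?U k c"
    unfolding proper_on_def
  proof (intro conjI ballI)
    fix u assume u: "u \<in> ?U"
    then show "c u < k" using proper cA[of u] cB[of u] unfolding proper_on_def by auto
    fix v assume v: "v \<in> nb ?U u"
    from u show "c u \<noteq> c v"
    proof
      assume u: "u \<in> A"
      then have "v \<in> nb A u" "v \<in> A" using v nbA[of u] nb_subset[of A u] by auto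
      then show ?thesis using u proper(1) cA[of u] cA[of v] unfolding proper_on_def by auto
    next
      assume u: "u \<in> B"
      then have "v \<in> nb B u" "v \<in> B" using v nbB[of u] nb_subset[of B u] by auto
      then show ?thesis using u proper(2) cB[of u] cB[of v] unfolding proper_on_def by auto
    qed
  qed
  moreover have "(\<exists>i<k. unique_at ?U c z i) \<or> (z \<in> X \<union> Y \<and> (\<exists>i<k. mono_at ?U c z i))"
    if "z \<in> ?U" for z
    using that
  proof
    assume z: "z \<in> A"
    then show ?thesis by (rule pcf_reservedE[OF assms(1)]) (use uA[OF z] in blast)+
  next
    assume z: "z \<in> B"
    then show ?thesis by (rule pcf_reservedE[OF assms(2)]) (use uB[OF z] in blast)+
  qed
  ultimately show ?thesis unfolding pcf_reserved_def by blast
qed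

theorem connected_sparse_24_11_pcf_4:
  assumes "finite W" "W \<noteq> {}" "connected_on W" "sparse 11 24 W"
  shows "pentagon_cactus W \<or> (\<exists>c. pcf_on W 4 c)"
  using assms
proof (induction "card W" arbitrary: W rule: less_induct)
  case less
  have IH: "pentagon_cactus U \<or> (\<exists>c. pcf_on U 4 c)" if "U \<subset> W" "U \<noteq> {}" "connected_on U" for U
  proof (rule less.hyps)
    show "card U < card W" using that(1) less.prems(1) by (rule psubset_card_mono[rotated])
    show "finite U" using that(1) less.prems(1) finite_subset by blast
    show "sparse 11 24 U" using sparse_subset[OF less.prems(4)] that(1) by blast
  qed (use that in auto)
  have fin: "finite (nb W v)" for v using finite_nb less.prems by blast
  consider x where "W = {x}" | v where "W \<noteq> {v}" "v \<in> W" "card (nb W v) = 1"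
    | p q r s where "{p, q, r, s} \<subseteq> W" "q \<in> nb W p" "r \<in> nb W q" "s \<in> nb W r"
      "p \<noteq> r" "q \<noteq> s" "\<forall>v \<in> {p, q, r, s}. card (nb W v) = 2"
  proof (rule ccontr)
    assume no: "\<not> thesis"
    note * = that
    have "2 \<le> card (nb W v)" if v: "v \<in> W" for v
    proof -
      have "W \<noteq> {v}" using *(1) no by blast
      then have "card (nb W v) \<noteq> 0"
        using connected_on_nb_nonempty[OF less.prems(3) v] fin by simp
      moreover have "card (nb W v) \<noteq> 1" using *(2)[OF \<open>W \<noteq> {v}\<close> v] no by blast
      ultimately show ?thesis by linarith
    qed
    then have "\<not> sparse 11 24 W"
      using *(3) no less.prems(1,2) by (intro not_sparse_24_11) blast+
    then show False using less.prems(4) by blast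
  qed
  then show ?case
  proof cases
    case (1 x)
    then show ?thesis by (simp add: pentagon_cactus.single)
  next
    case (2 v)
    obtain u where u: "nb W v = {u}" using 2(3) by (auto simp: card_1_singleton_iff)
    have uW: "u \<in> W - {v}" using u nb_subset[of W v] not_in_nb[of v W] by auto
    have conn: "connected_on (W - {v})"
      using connected_on_Diff[OF less.prems(3), of "{v}" u] u by auto
    then have "pentagon_cactus (W - {v}) \<or> (\<exists>c. pcf_on (W - {v}) 4 c)"
      using IH[of "W - {v}"] 2 uW by blast
    \<comment> \<open>If a cactus remains, its defect is placed at \<open>u\<close>, where the leaf
      \<open>v\<close> repairs it.\<close>
    then obtain c where "pcf_reserved (W - {v}) 4 {u} c"
      using pcf_or_cactus_reserved[OF conn uW] by blast
    then have c: "proper_on (W - {v}) 4 c"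
      "\<And>z. z \<in> W - {v} \<Longrightarrow> (\<exists>i<4. unique_at (W - {v}) c z i) \<or> (z = u \<and> (\<exists>i<4. mono_at (W - {v}) c z i))"
      unfolding pcf_reserved_def by simp_all
    obtain j where j: "unique_at (W - {v}) c u j \<or> mono_at (W - {v}) c u j" using c(2)[OF uW] by blast
    obtain a where a: "a < 4" "a \<notin> set [c u, j]" using ex_colour_avoiding[of "[c u, j]" 4] by auto
    let ?c = "c(v := a)"
    have nbz: "nb W z - (W - {v}) = (if z = u then {v} else {})" if "z \<in> W - {v}" for z
    proof (cases "z = u")
      case True
      have "v \<in> nb W u" using nb_symD[of u W v] u 2(2) by blast
      then show ?thesis using True nb_subset[of W z] by auto
    next
      case False
      then have "v \<notin> nb W z" using nb_symD[of v W z] u that by auto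
      then show ?thesis using False nb_subset[of W z] by auto
    qed
    have "pcf_on W 4 ?c"
    proof (rule pcf_on_extend[OF c(1)])
      fix z assume z: "z \<in> W - {v}"
      show "inj_on ?c (nb W z) \<or> (\<exists>i. unique_at (W - {v}) c z i \<and> (\<forall>p \<in> nb W z - (W - {v}). ?c p \<noteq> i)) \<or>
        (\<exists>i p. mono_at (W - {v}) c z i \<and> nb W z - (W - {v}) = {p} \<and> ?c p \<noteq> i)"
      proof (cases "z = u")
        case True
        then show ?thesis using j nbz[OF z] a by auto
      next
        case False
        then show ?thesis using c(2)[OF z] nbz[OF z] by auto
      qed
    next
      fix z assume "z \<in> W - (W - {v})"
      then have "z = v" by blast
      then show "\<exists>i. unique_at W ?c z i" using unique_at_singleton[OF u] by blast
    qed (use a u uW in auto)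
    then show ?thesis by blast
  next
    case (3 p q r s)
    have W: "p \<in> W" "q \<in> W" "r \<in> W" "s \<in> W" using 3(1) by auto
    have rev_nb: "p \<in> nb W q" "q \<in> nb W r" "r \<in> nb W s"
      using 3(2-4) W nb_symD by blast+
    obtain x where x: "nb W p = {x, q}" "x \<noteq> q"
      using 3(2,7) by (auto simp: card_2_iff doubleton_eq_iff)
    obtain y where y: "nb W s = {r, y}" "y \<noteq> r"
      using 3(7) rev_nb(3) by (auto simp: card_2_iff doubleton_eq_iff)
    have q: "nb W q = {p, r}" using 3(3,5,7) rev_nb(1) by (auto simp: card_2_iff)
    have r: "nb W r = {q, s}" using 3(4,6,7) rev_nb(2) by (auto simp: card_2_iff)
    have ne: "p \<noteq> q" "q \<noteq> r" "r \<noteq> s" "x \<noteq> p" "y \<noteq> s"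
      using x y q r not_in_nb[of p W] not_in_nb[of q W] not_in_nb[of r W] not_in_nb[of s W] by auto
    have xyW: "x \<in> W" "y \<in> W" using x y nb_subset[of W p] nb_subset[of W s] by auto
    have xp: "p \<in> nb W x" and ys: "s \<in> nb W y" using nb_symD[of x W p] nb_symD[of y W s] x y W by auto
    \<comment> \<open>How the path closes up: a triangle, a 4-cycle, a pendant pentagon, or two
      different outer neighbours.\<close>
    consider "p = s" | "p \<noteq> s" "x = s" | "p \<noteq> s" "x \<noteq> s" "x = y" | "p \<noteq> s" "x \<noteq> s" "x \<noteq> y" by blast
    then show ?thesis
    proof cases
      case 1
      have "x = r" using x y 1 ne by (auto simp: doubleton_eq_iff)
      then have "\<exists>c. pcf_on W 4 c"
        by (intro closed_path_pcf_4[OF less.prems(1,3) 3(1)]) (use 1 x y q r in auto)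
      then show ?thesis by blast
    next
      case 2
      have "y = p" using xp y 2 3(5) by auto
      then have "\<exists>c. pcf_on W 4 c"
        by (intro closed_path_pcf_4[OF less.prems(1,3) 3(1)]) (use 2 x y q r in auto)
      then show ?thesis by blast
    next
      case xy: 3
      have xr: "x \<noteq> r" using y(2) xy(3) by simp
      let ?U = "W - {p, q, r, s}"
      have U: "?U \<union> {p, q, r, s} = W" using 3(1) by blast
      have xU: "x \<in> ?U" using xyW x ne xr xy by auto
      have conn: "connected_on ?U"
        by (rule connected_on_Diff[OF less.prems(3), of _ x]) (use x y q r xy in auto)
      have pent: "pendant_pentagon ?U x p q r s"
        unfolding pendant_pentagon_def U using xU x y q r ne 3(5,6) xy by auto
      from IH[of ?U] xU W(1) conn consider "pentagon_cactus ?U" | c where "pcf_on ?U 4 c" by blast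
      then show ?thesis
      proof cases
        case 1
        then show ?thesis using pentagon_cactus.pentagon[OF 1 pent] U by simp
      next
        case (2 c)
        show ?thesis
        \<comment> \<open>A lone \<open>x\<close> is colourable but has no unique colour to protect;
          it is treated as the seed of a cactus.\<close>
        proof (cases "?U = {x}")
          case True
          then have "pentagon_cactus ?U" using pentagon_cactus.single by simp
          then show ?thesis using pentagon_cactus.pentagon[OF _ pent] U by simp
        next
          case False
          then have cf: "\<exists>i. unique_at ?U c z i" if "z \<in> ?U" for z
            using 2 connected_on_nb_nonempty[OF conn that] that xU conn unfolding pcf_on_def
            by (metis connected_on_nb_nonempty singletonD)
          obtain t where t: "unique_at ?U c x t" using cf[OF xU] by blast
          obtain d where d: "proper_on W 4 d" "\<And>v. v \<in> ?U \<Longrightarrow> d v = c v"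
            "\<And>z i. z \<in> ?U \<Longrightarrow> unique_at ?U c z i \<Longrightarrow> z \<noteq> x \<Longrightarrow> unique_at W d z i"
            "\<And>z i. z \<in> ?U \<Longrightarrow> z \<noteq> x \<Longrightarrow> mono_at ?U c z i \<Longrightarrow> mono_at W d z i"
            "\<And>z. z \<in> insert x (W - ?U) \<Longrightarrow> \<exists>i. unique_at W d z i"
            using pendant_pentagon_colour_far[OF pent pcf_on_proper[OF 2] t, unfolded U] by blast
          have "\<exists>i. unique_at W d z i" if "z \<in> W" for z
          proof (cases "z \<in> ?U \<and> z \<noteq> x")
            case True
            then show ?thesis using cf[of z] d(3)[of z] by blast
          next
            case False
            then show ?thesis using d(5)[of z] that by blast
          qed
          then have "pcf_on W 4 d" using d(1) unfolding pcf_on_def by blast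
          then show ?thesis by blast
        qed
      qed
    next
      case 4
      \<comment> \<open>The outer neighbours are not on the path: a coincidence would give a third
        neighbour to a path vertex.\<close>
      have "x \<noteq> r"
      proof
        assume "x = r"
        then show False using xp r ne 4 by auto
      qed
      have "y \<noteq> q"
      proof
        assume "y = q"
        then show False using ys q ne 4 by auto
      qed
      have "y \<noteq> p"
      proof
        assume "y = p"
        then show False using ys x 4 3(6) by auto
      qed
      let ?U = "W - {p, q, r, s}"
      have U: "x \<in> ?U" "y \<in> ?U" using xyW x y ne 4 \<open>x \<noteq> r\<close> \<open>y \<noteq> q\<close> \<open>y \<noteq> p\<close> by auto
      have dist: "distinct [p, q, r, s]" using ne 3(5,6) 4 by auto
      note insert = pcf_on_insert_path[OF 3(1) dist x(1) q r y(1) U 4(3)]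
      show ?thesis
      proof (cases "connected_on ?U")
        case True
        then have "pentagon_cactus ?U \<or> (\<exists>c. pcf_on ?U 4 c)" using IH[of ?U] U W(1) by blast
        then obtain c where "pcf_reserved ?U 4 {x} c"
          using pcf_or_cactus_reserved[OF True U(1)] by blast
        then have "pcf_reserved ?U 4 {x, y} c" unfolding pcf_reserved_def by blast
        then show ?thesis using insert by blast
      next
        case False
        \<comment> \<open>Both components may be cacti; each then has its defect at its own vertex
          \<open>x\<close> or \<open>y\<close>, and the two ends of the path repair them.\<close>
        obtain A B where AB: "A \<union> B = ?U" "A \<inter> B = {}" "x \<in> A" "y \<in> B" "connected_on A" "connected_on B"
          "\<And>u v. u \<in> A \<Longrightarrow> v \<in> B \<Longrightarrow> (u, v) \<notin> E"
          by (rule not_connected_on_Diff[OF less.prems(3) _ U(1) False, of y]) (use x y q r in auto)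
        have IHA: "pentagon_cactus A \<or> (\<exists>c. pcf_on A 4 c)"
          using IH[of A] AB W(1) by blast
        have IHB: "pentagon_cactus B \<or> (\<exists>c. pcf_on B 4 c)"
          using IH[of B] AB W(1) by blast
        obtain c1 where c1: "pcf_reserved A 4 {x} c1"
          using pcf_or_cactus_reserved[OF AB(5,3) IHA] by blast
        obtain c2 where c2: "pcf_reserved B 4 {y} c2"
          using pcf_or_cactus_reserved[OF AB(6,4) IHB] by blast
        obtain c where "pcf_reserved ?U 4 {x, y} c"
          using pcf_reserved_disjoint_Un[OF c1 c2 AB(2,7)] unfolding AB(1) by (auto simp: insert_commute)
        then show ?thesis using insert by blast
      qed
    qed
  qed
qed

end

section \<open>The blocks of a pentagon cactus are its pentagons\<close>

section \<open>Blocks of pentagon cacti\<close>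

lemma reachable_closed:
  assumes "u \<rightarrow>\<^sup>*\<^bsub>H\<^esub> v" "u \<in> A" "\<And>x y. x \<in> A \<Longrightarrow> x \<rightarrow>\<^bsub>H\<^esub> y \<Longrightarrow> y \<in> verts H \<Longrightarrow> y \<in> A"
  shows "v \<in> A"
proof -
  from assms(1) have "(u, v) \<in> rtrancl_on (verts H) (arcs_ends H)" by (simp add: reachable_def)
  then show ?thesis
    by (induction rule: rtrancl_on_induct) (use assms(2,3) in auto)
qed

definition induced :: "'a pair_pre_digraph \<Rightarrow> 'a set \<Rightarrow> 'a pair_pre_digraph" where
  "induced G U = \<lparr> pverts = U, parcs = {(u, v). u \<in> U \<and> v \<in> U \<and> (u, v) \<in> parcs G} \<rparr>"

lemma induced_simps [simp]:
  "pverts (induced G U) = U" "(u, v) \<in> parcs (induced G U) \<longleftrightarrow> u \<in> U \<and> v \<in> U \<and> (u, v) \<in> parcs G"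
  by (simp_all add: induced_def)

lemma pair_graph_induced:
  assumes "pair_graph G" "U \<subseteq> pverts G"
  shows "pair_graph (induced G U)"
proof -
  interpret pair_graph G by fact
  have sub: "parcs (induced G U) \<subseteq> parcs G" by (auto simp: induced_def)
  show ?thesis
  proof
    show "finite (pverts (induced G U))" using finite_subset[OF assms(2) pair_finite_verts] by simp
    show "finite (parcs (induced G U))" using sub pair_finite_arcs by (rule finite_subset)
    show "symmetric (with_proj (induced G U))"
      using sym_arcs by (auto simp: symmetric_def sym_def)
    show "fst e \<noteq> snd e" if "e \<in> parcs (induced G U)" for e
      using that sub pair_no_loops by blast
  qed (auto simp: induced_def)
qed

lemma subgraph_induced:
  assumes "pair_graph G" "U \<subseteq> pverts G"
  shows "subgraph (with_proj (induced G U)) (with_proj G)"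
proof -
  interpret G: pair_graph G by fact
  interpret I: pair_graph "induced G U" by (rule pair_graph_induced[OF assms])
  show ?thesis
    using assms(2) G.wf_digraph I.wf_digraph
    by (auto simp: subgraph_def compatible_def induced_def)
qed

text \<open>For the maximality of blocks: a block on vertices of a pentagon is a subgraph of that
  pentagon.\<close>

lemma subgraph_induced_of_subset:
  assumes "pair_graph G" "U \<subseteq> pverts G" "subgraph H (with_proj G)" "verts H \<subseteq> U"
  shows "subgraph H (with_proj (induced G U))"
proof -
  interpret I: pair_graph "induced G U" by (rule pair_graph_induced[OF assms(1,2)])
  interpret H: wf_digraph H using assms(3) by (simp add: subgraph_def)
  have H: "tail H = fst" "head H = snd" "arcs H \<subseteq> parcs G"
    using assms(3) by (auto simp: subgraph_def compatible_def)
  have "arcs H \<subseteq> parcs (induced G U)"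
  proof
    fix e assume e: "e \<in> arcs H"
    have "fst e \<in> U" "snd e \<in> U"
      using H.tail_in_verts[OF e] H.head_in_verts[OF e] assms(4) H by auto
    then show "e \<in> parcs (induced G U)" using e H(3) by (cases e) auto
  qed
  then show ?thesis
    using assms(3,4) I.wf_digraph by (auto simp: subgraph_def compatible_def)
qed

lemma pair_graph_simple_adjacency: "pair_graph G \<Longrightarrow> simple_adjacency (parcs G)"
proof -
  assume "pair_graph G"
  then interpret pair_graph G .
  show ?thesis
    using sym_arcs no_loops' by unfold_locales (auto simp: symmetric_def sym_def)
qed

context simple_adjacency
begin

text \<open>Unlike in \<open>pendant_pentagon\<close>, the five vertices play equal roles and
  neighbourhoods are taken among them, so the cycle can be rotated.\<close>

definition pentagon :: "'a \<Rightarrow> 'a \<Rightarrow> 'a \<Rightarrow> 'a \<Rightarrow> 'a \<Rightarrow> bool" where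
  "pentagon x p q r s \<longleftrightarrow> distinct [x, p, q, r, s] \<and>
    nb {x, p, q, r, s} x = {s, p} \<and> nb {x, p, q, r, s} p = {x, q} \<and> nb {x, p, q, r, s} q = {p, r} \<and>
    nb {x, p, q, r, s} r = {q, s} \<and> nb {x, p, q, r, s} s = {r, x}"

lemma pentagon_rotate: "pentagon x p q r s \<Longrightarrow> pentagon p q r s x"
  unfolding pentagon_def by (auto simp: insert_commute)

lemma pendant_pentagon_imp_pentagon:
  assumes "pendant_pentagon W x p q r s"
  shows "pentagon x p q r s"
proof -
  let ?V = "W \<union> {p, q, r, s}" and ?C = "{x, p, q, r, s}"
  have P: "x \<in> W" "W \<inter> {p, q, r, s} = {}" "distinct [p, q, r, s]"
    "nb ?V p = {x, q}" "nb ?V q = {p, r}" "nb ?V r = {q, s}" "nb ?V s = {r, x}"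
    using assms unfolding pendant_pentagon_def by auto
  have C: "nb ?C z = nb ?V z \<inter> ?C" for z using P(1) by (auto simp: nb_def)
  have "nb ?C x = {s, p}"
    unfolding C nb_pendant_pentagon(1)[OF assms] using P(2) not_in_nb[of x W] nb_subset[of W x] by auto
  then show ?thesis
    unfolding pentagon_def using C[of p] C[of q] C[of r] C[of s] P by auto
qed

text \<open>If \<open>H\<close> contains a new vertex of the last pentagon and also a vertex off
  that pentagon, every walk between them passes \<open>x\<close>. So \<open>x\<close> is a cut
  vertex of \<open>H\<close>, or it is missing and \<open>H\<close> is disconnected. The first
  alternative covers the cactus without pentagons.\<close>

lemma biconnected_subset_pentagon:
  assumes "pentagon_cactus W" "verts H \<subseteq> W" "verts H \<noteq> {}" "arcs_ends H \<subseteq> E"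
    and conn: "\<And>u v. u \<in> verts H \<Longrightarrow> v \<in> verts H \<Longrightarrow> u \<rightarrow>\<^sup>*\<^bsub>H\<^esub> v"
    and cut: "\<nexists>v. cut_vertex H v"
  shows "(\<exists>x. W = {x}) \<or> (\<exists>x p q r s. pentagon x p q r s \<and> {x, p, q, r, s} \<subseteq> W \<and> verts H \<subseteq> {x, p, q, r, s})"
  using assms(1,2)
proof (induction rule: pentagon_cactus.induct)
  case (single x)
  then show ?case by blast
next
  case (pentagon W x p q r s)
  let ?P = "{p, q, r, s}"
  have pent: "pentagon x p q r s" using pendant_pentagon_imp_pentagon[OF pentagon.hyps(2)] .
  have xW: "x \<in> W" using pentagon.hyps(2) by (simp add: pendant_pentagon_def)
  have subC: "{x, p, q, r, s} \<subseteq> W \<union> ?P" using xW by blast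
  show ?case
  proof (cases "verts H \<subseteq> W")
    case True
    show ?thesis
      using pentagon.IH[OF True]
    proof (elim disjE exE conjE)
      fix y assume "W = {y}"
      then have "verts H \<subseteq> {x, p, q, r, s}" using True xW by blast
      then show ?thesis using pent subC by blast
    next
      fix x' p' q' r' s'
      assume "pentagon x' p' q' r' s'" "{x', p', q', r', s'} \<subseteq> W" "verts H \<subseteq> {x', p', q', r', s'}"
      then show ?thesis by (intro disjI2 exI conjI) (assumption, blast, assumption)
    qed
  next
    case False
    then obtain a where a: "a \<in> verts H" "a \<in> ?P" using pentagon.prems by blast
    have closed: "v \<in> insert x ?P" if "u \<in> ?P" "(u, v) \<in> E" "v \<in> W \<union> ?P" for u v
    proof -
      have "v \<in> nb (W \<union> ?P) u" using that by (simp add: nb_def)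
      then show ?thesis using pentagon.hyps(2) that(1) unfolding pendant_pentagon_def by auto
    qed
    have sub: "verts H \<subseteq> insert x ?P"
    proof (rule ccontr)
      assume "\<not> verts H \<subseteq> insert x ?P"
      then obtain b where b: "b \<in> verts H" "b \<notin> insert x ?P" by blast
      have ax: "a \<noteq> x" using a(2) xW pentagon.hyps(2) by (auto simp: pendant_pentagon_def)
      have reach: "a \<rightarrow>\<^sup>*\<^bsub>H\<^esub> b" using conn a b by blast
      show False
      proof (cases "x \<in> verts H")
        case True
        let ?D = "pre_digraph.del_vert H x"
        have "\<not> a \<rightarrow>\<^sup>*\<^bsub>?D\<^esub> b"
        proof
          assume "a \<rightarrow>\<^sup>*\<^bsub>?D\<^esub> b"
          then have "b \<in> ?P"
          proof (rule reachable_closed[OF _ a(2)])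
            fix u v assume u: "u \<in> ?P" and uv: "u \<rightarrow>\<^bsub>?D\<^esub> v" and v: "v \<in> verts ?D"
            have "(u, v) \<in> arcs_ends H"
              using uv by (auto simp: arcs_ends_conv pre_digraph.del_vert_simps)
            then have "(u, v) \<in> E" using assms(4) by blast
            moreover have "v \<in> W \<union> ?P" "v \<noteq> x" using v pentagon.prems by (auto simp: pre_digraph.del_vert_simps)
            ultimately show "v \<in> ?P" using closed[OF u] by blast
          qed
          then show False using b by blast
        qed
        then have "cut_vertex H x"
          unfolding cut_vertex_def using True a b ax reach by blast
        then show False using cut by blast
      next
        case xH: False
        from reach have "b \<in> ?P"
        proof (rule reachable_closed[OF _ a(2)])
          fix u v assume u: "u \<in> ?P" and uv: "u \<rightarrow>\<^bsub>H\<^esub> v" and v: "v \<in> verts H"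
          have "(u, v) \<in> E" using assms(4) uv by blast
          moreover have "v \<in> W \<union> ?P" "v \<noteq> x" using v pentagon.prems xH by auto
          ultimately show "v \<in> ?P" using closed[OF u] by blast
        qed
        then show False using b by blast
      qed
    qed
    then show ?thesis using pent subC by blast
  qed
qed

end

lemma reachable_path4:
  assumes "wf_digraph H" "symmetric H" "p \<rightarrow>\<^bsub>H\<^esub> q" "q \<rightarrow>\<^bsub>H\<^esub> r" "r \<rightarrow>\<^bsub>H\<^esub> s" "u \<in> {p, q, r, s}" "v \<in> {p, q, r, s}"
  shows "u \<rightarrow>\<^sup>*\<^bsub>H\<^esub> v"
proof -
  interpret wf_digraph H by fact
  have "p \<in> verts H" using assms(3) by (simp add: adj_in_verts)
  then have from_p: "p \<rightarrow>\<^sup>*\<^bsub>H\<^esub> w" if "w \<in> {p, q, r, s}" for w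
    using that assms(3-5) reachable_adj_trans by blast
  have "u \<rightarrow>\<^sup>*\<^bsub>H\<^esub> p" using symmetric_reachable[OF assms(2) from_p[OF assms(6)]] .
  also have "p \<rightarrow>\<^sup>*\<^bsub>H\<^esub> v" by (rule from_p[OF assms(7)])
  finally show ?thesis .
qed

text \<open>Deleting \<open>x\<close> leaves the path \<open>p\<close>, \<open>q\<close>,
  \<open>r\<close>, \<open>s\<close>, so \<open>x\<close> is no cut vertex; rotating the cycle
  transfers this to the other four.\<close>

lemma
  assumes G: "pair_graph G" and sub: "{x, p, q, r, s} \<subseteq> pverts G"
    and pent: "simple_adjacency.pentagon (parcs G) x p q r s"
  shows connected_pentagon: "Digraph_Component.connected (with_proj (induced G {x, p, q, r, s}))"
    and cut_vertex_pentagon: "\<not> cut_vertex (with_proj (induced G {x, p, q, r, s})) x"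
    and digraph_iso_pentagon: "digraph_iso (with_proj (induced G {x, p, q, r, s})) (with_proj (cycle_graph 5))"
proof -
  interpret simple_adjacency "parcs G" by (rule pair_graph_simple_adjacency[OF G])
  let ?C = "{x, p, q, r, s}"
  let ?I = "induced G ?C"
  let ?H = "with_proj ?I"
  interpret I: pair_graph ?I by (rule pair_graph_induced[OF G sub])
  have dist: "distinct [x, p, q, r, s]" and nbs: "nb ?C x = {s, p}" "nb ?C p = {x, q}" "nb ?C q = {p, r}"
    "nb ?C r = {q, s}" "nb ?C s = {r, x}"
    using pent unfolding pentagon_def by auto
  have arc: "(u, v) \<in> parcs ?I \<longleftrightarrow> u \<in> ?C \<and> v \<in> nb ?C u" for u v
    by (auto simp: nb_def)
  have arcs: "parcs ?I = {(x, p), (p, x), (p, q), (q, p), (q, r), (r, q), (r, s), (s, r), (s, x), (x, s)}"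
    (is "_ = ?A")
  proof -
    have "parcs ?I = (\<Union>u\<in>?C. Pair u ` nb ?C u)"
    proof (rule set_eqI)
      fix a :: "'a \<times> 'a"
      obtain u v where "a = (u, v)" by (cases a)
      then show "a \<in> parcs ?I \<longleftrightarrow> a \<in> (\<Union>u\<in>?C. Pair u ` nb ?C u)" using arc[of u v] by blast
    qed
    also have "\<dots> = Pair x ` {s, p} \<union> (Pair p ` {x, q} \<union> (Pair q ` {p, r} \<union>
        (Pair r ` {q, s} \<union> (Pair s ` {r, x} \<union> {}))))"
      by (simp only: UN_insert UN_empty nbs)
    also have "\<dots> = ?A" by auto
    finally show ?thesis .
  qed
  let ?D = "pre_digraph.del_vert ?H x"
  have ends_D: "arcs_ends ?D = {(u, v) \<in> ?A. u \<noteq> x \<and> v \<noteq> x}"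
    unfolding arcs_ends_conv pre_digraph.del_vert_simps with_proj_simps arcs by force
  have D: "u \<rightarrow>\<^sup>*\<^bsub>?D\<^esub> v" if "u \<in> {p, q, r, s}" "v \<in> {p, q, r, s}" for u v
  proof (rule reachable_path4[OF _ _ _ _ _ that])
    show "wf_digraph ?D" by (rule I.wf_digraph_del_vert)
    show "symmetric ?D" unfolding symmetric_def ends_D by (auto simp: sym_def)
    show "p \<rightarrow>\<^bsub>?D\<^esub> q" "q \<rightarrow>\<^bsub>?D\<^esub> r" "r \<rightarrow>\<^bsub>?D\<^esub> s"
      unfolding ends_D using dist by auto
  qed
  show "\<not> cut_vertex ?H x"
    unfolding cut_vertex_def using D by auto
  have from_x: "x \<rightarrow>\<^sup>*\<^bsub>?H\<^esub> v" if v: "v \<in> ?C" for v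
  proof (cases "v = x")
    case True
    then show ?thesis by simp
  next
    case False
    have xp: "(x, p) \<in> parcs ?I" unfolding arcs by simp
    have "p \<rightarrow>\<^sup>*\<^bsub>?H\<^esub> v"
    proof (rule reachable_path4)
      show "wf_digraph ?H" by (rule I.wf_digraph)
      show "symmetric ?H" by (rule I.sym_arcs)
      show "v \<in> {p, q, r, s}" using v False by blast
    qed (simp_all only: with_proj_simps arcs, simp_all)
    then show ?thesis by (rule I.adj_reachable_trans[OF xp])
  qed
  have "strongly_connected ?H"
  proof
    fix u v assume "u \<in> verts ?H" "v \<in> verts ?H"
    then have "x \<rightarrow>\<^sup>*\<^bsub>?H\<^esub> u" "x \<rightarrow>\<^sup>*\<^bsub>?H\<^esub> v" using from_x by auto
    then show "u \<rightarrow>\<^sup>*\<^bsub>?H\<^esub> v"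
      using symmetric_reachable[OF I.sym_arcs] I.reachable_trans by blast
  qed simp
  then show "Digraph_Component.connected ?H"
    unfolding Digraph_Component.connected_def strongly_connected_def
    using I.reachable_mk_symmetricI by simp
  \<comment> \<open>The labels follow the cycle, so adjacent vertices get labels that are
    consecutive modulo 5.\<close>
  define h where "h v = (if v = x then 0 else if v = p then 1 else if v = q then 2 else if v = r then 3 else (4::nat))" for v
  have h: "h x = 0" "h p = 1" "h q = 2" "h r = 3" "h s = 4" using dist by (auto simp: h_def)
  define hom where "hom = \<lparr> iso_verts = h, iso_arcs = (\<lambda>(u, v). (h u, h v)), iso_head = snd, iso_tail = fst \<rparr>"
  have inj: "inj_on h ?C" using dist h by auto
  have "pre_digraph.digraph_isomorphism ?H hom"
    unfolding pre_digraph.digraph_isomorphism_def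
  proof (intro conjI)
    show "wf_digraph ?H" by (rule I.wf_digraph)
    show "inj_on (iso_verts hom) (verts ?H)" using inj by (simp add: hom_def)
    show "inj_on (iso_arcs hom) (arcs ?H)"
    proof (rule inj_onI, clarify)
      fix a b a' b' assume "(a, b) \<in> arcs ?H" "(a', b') \<in> arcs ?H" "iso_arcs hom (a, b) = iso_arcs hom (a', b')"
      then show "a = a' \<and> b = b'" using inj_onD[OF inj] by (simp add: hom_def)
    qed
  qed (auto simp: hom_def)
  moreover have "with_proj (cycle_graph 5) = app_iso hom ?H"
  proof -
    have V: "{..<5} = h ` ?C" by (simp add: h lessThan_nat_numeral lessThan_Suc insert_commute)
    have A: "{(i, j). i < 5 \<and> j < 5 \<and> (j = Suc i mod 5 \<or> i = Suc j mod 5)} =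
      {(0, 1), (1, 0), (1, 2), (2, 1), (2, 3), (3, 2), (3, 4), (4, 3), (4, 0), (0, 4::nat)}"
    proof (rule set_eqI, clarify)
      fix i j :: nat
      show "(i, j) \<in> {(i, j). i < 5 \<and> j < 5 \<and> (j = Suc i mod 5 \<or> i = Suc j mod 5)} \<longleftrightarrow>
        (i, j) \<in> {(0, 1), (1, 0), (1, 2), (2, 1), (2, 3), (3, 2), (3, 4), (4, 3), (4, 0), (0, 4)}"
      proof (cases "i < 5 \<and> j < 5")
        case True
        then have "i = 0 \<or> i = 1 \<or> i = 2 \<or> i = 3 \<or> i = 4" "j = 0 \<or> j = 1 \<or> j = 2 \<or> j = 3 \<or> j = 4"
          by auto
        then show ?thesis by (elim disjE) simp_all
      next
        case False
        then show ?thesis by auto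
      qed
    qed
    have B: "(\<lambda>(u, v). (h u, h v)) ` parcs ?I =
      {(0, 1), (1, 0), (1, 2), (2, 1), (2, 3), (3, 2), (3, 4), (4, 3), (4, 0), (0, 4)}"
      unfolding arcs by (simp add: h)
    show ?thesis
      unfolding cycle_graph_def A V by (simp add: with_proj_def app_iso_def hom_def B)
  qed
  ultimately show "digraph_iso ?H (with_proj (cycle_graph 5))"
    unfolding digraph_iso_def by blast
qed

text \<open>A block lies within a pentagon of the cactus, and that pentagon is itself connected
  without a cut vertex, so maximality makes the two equal.\<close>

lemma pentagon_cactus_in_C5_block_graphs:
  assumes G: "pair_graph G" "Digraph_Component.connected (with_proj G)" "2 \<le> card (pverts G)"
    and cactus: "simple_adjacency.pentagon_cactus (parcs G) (pverts G)"
  shows "G \<in> \<F>"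
proof -
  interpret simple_adjacency "parcs G" by (rule pair_graph_simple_adjacency[OF G(1)])
  let ?Q = "\<lambda>H. graph H \<and> Digraph_Component.connected H \<and> (\<nexists>v. cut_vertex H v)"
  have "digraph_iso (with_proj B) (with_proj (cycle_graph 5))" if "block G B" for B
  proof -
    let ?B = "with_proj B"
    have sub: "subgraph ?B (with_proj G)" and Q: "?Q ?B"
      and max: "\<And>H. H \<noteq> ?B \<Longrightarrow> subgraph ?B H \<Longrightarrow> subgraph H (with_proj G) \<Longrightarrow> \<not> ?Q H"
      using that unfolding block_def pre_digraph.max_subgraph_def by blast+
    interpret B: graph ?B using Q by blast
    have "strongly_connected ?B"
      using B.symmetric_connected_imp_strongly_connected[OF B.sym_arcs] Q by blast
    then have conn: "verts ?B \<noteq> {}" "\<And>u v. u \<in> verts ?B \<Longrightarrow> v \<in> verts ?B \<Longrightarrow> u \<rightarrow>\<^sup>*\<^bsub>?B\<^esub> v"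
      unfolding strongly_connected_def by blast+
    have vB: "verts ?B \<subseteq> pverts G" using sub by (simp add: subgraph_def)
    have "\<nexists>x. pverts G = {x}" using G(3) by auto
    moreover have "arcs_ends ?B \<subseteq> parcs G" using arcs_ends_mono[OF sub] by simp
    ultimately obtain x p q r s where pent: "pentagon x p q r s"
      and C: "{x, p, q, r, s} \<subseteq> pverts G" "verts ?B \<subseteq> {x, p, q, r, s}"
      using biconnected_subset_pentagon[OF cactus vB conn(1) _ conn(2)] Q by metis
    let ?H = "with_proj (induced G {x, p, q, r, s})"
    interpret H: pair_graph "induced G {x, p, q, r, s}" by (rule pair_graph_induced[OF G(1) C(1)])
    have rot: "pentagon p q r s x" "pentagon q r s x p" "pentagon r s x p q" "pentagon s x p q r"
      using pent pentagon_rotate by blast+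
    have perm: "{p, q, r, s, x} = {x, p, q, r, s}" "{q, r, s, x, p} = {x, p, q, r, s}"
      "{r, s, x, p, q} = {x, p, q, r, s}" "{s, x, p, q, r} = {x, p, q, r, s}"
      by auto
    have "\<not> cut_vertex ?H v" for v
    proof
      assume cut: "cut_vertex ?H v"
      then have "v \<in> {x, p, q, r, s}" by (simp add: cut_vertex_def)
      then show False
        using cut cut_vertex_pentagon[OF G(1) C(1) pent] cut_vertex_pentagon[OF G(1) _ rot(1), unfolded perm]
          cut_vertex_pentagon[OF G(1) _ rot(2), unfolded perm] cut_vertex_pentagon[OF G(1) _ rot(3), unfolded perm]
          cut_vertex_pentagon[OF G(1) _ rot(4), unfolded perm] C(1) by blast
    qed
    then have "?Q ?H" using H.graph_axioms connected_pentagon[OF G(1) C(1) pent] by blast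
    then have "?H = ?B"
      using max subgraph_induced[OF G(1) C(1)] subgraph_induced_of_subset[OF G(1) C(1) sub C(2)] by blast
    then show ?thesis using digraph_iso_pentagon[OF G(1) C(1) pent] by simp
  qed
  then show ?thesis using G by (simp add: C5_block_graphs_def)
qed

section \<open>From the graph parameters to vertex sets and back\<close>

section \<open>Translation to graphs\<close>

text \<open>Each edge comes from exactly two arcs, because arcs occur in opposite pairs and there
  are no loops.\<close>

lemma double_card_edges:
  assumes "pair_graph G"
  shows "2 * card (edges G) = card (parcs G)"
proof -
  interpret pair_graph G by fact
  let ?f = "\<lambda>(u, v). {u, v}"
  have edges: "edges G = ?f ` parcs G" by (auto simp: edges_def)
  have fin: "finite (edges G)" unfolding edges using pair_finite_arcs by simp
  have "(\<Sum>e\<in>edges G. card {a \<in> parcs G. ?f a = e}) = (\<Sum>a\<in>parcs G. 1)"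
  proof (rule sum_multicount_gen[OF fin pair_finite_arcs], rule ballI)
    fix a assume "a \<in> parcs G"
    then have "{e \<in> edges G. ?f a = e} = {?f a}" using edges by blast
    then show "card {e \<in> edges G. ?f a = e} = 1" by simp
  qed
  moreover have "card {a \<in> parcs G. ?f a = e} = 2" if e: "e \<in> edges G" for e
  proof -
    obtain u v where uv: "e = {u, v}" "(u, v) \<in> parcs G" using e by (auto simp: edges_def)
    then have "(v, u) \<in> parcs G" "u \<noteq> v"
      using sym_arcs no_loops' by (auto simp: symmetric_def sym_def)
    then have "{a \<in> parcs G. ?f a = e} = {(u, v), (v, u)}"
      using uv by (auto simp: doubleton_eq_iff)
    then show ?thesis using \<open>u \<noteq> v\<close> by simp
  qed
  ultimately show ?thesis by simp
qed

text \<open>The maximum is compared with the induced subgraph on each \<open>U\<close>, whose degree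
  sum is its number of arcs, that is, twice its number of edges.\<close>

lemma sparse_of_mad:
  assumes G: "pair_graph G" and "mad G < real b / real a" "0 < a"
  shows "simple_adjacency.sparse (parcs G) a b (pverts G)"
proof -
  interpret simple_adjacency "parcs G" by (rule pair_graph_simple_adjacency[OF G])
  interpret pair_graph G by (rule G)
  show ?thesis
    unfolding sparse_def
  proof (intro allI impI)
    fix U assume U: "U \<subseteq> pverts G" "U \<noteq> {}"
    have fin: "finite U" using U(1) pair_finite_verts finite_subset by blast
    let ?H = "induced G U"
    have H: "pair_graph ?H" by (rule pair_graph_induced[OF G U(1)])
    have arcs: "parcs ?H = (SIGMA u:U. nb U u)" by (auto simp: induced_def nb_def)
    have "card (parcs ?H) = (\<Sum>u\<in>U. card (nb U u))"
      unfolding arcs using fin finite_nb by (simp add: card_SigmaI)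
    then have "average_degree ?H = real (\<Sum>u\<in>U. card (nb U u)) / real (card U)"
      using double_card_edges[OF H] unfolding average_degree_def
      by (metis induced_simps(1) of_nat_mult of_nat_numeral)
    moreover have "average_degree ?H \<le> mad G"
      using average_degree_le_mad[OF G H subgraph_induced[OF G U(1)]] U(2) by simp
    ultimately have "real (\<Sum>u\<in>U. card (nb U u)) / real (card U) < real b / real a"
      using assms(2) by linarith
    moreover have "0 < card U" using fin U(2) by (simp add: card_gt_0_iff)
    ultimately have "real (\<Sum>u\<in>U. card (nb U u)) * real a < real b * real (card U)"
      using assms(3) by (simp add: divide_simps)
    then have "real (a * (\<Sum>u\<in>U. card (nb U u))) < real (b * card U)"
      by (simp add: mult.commute)
    then show "a * (\<Sum>u\<in>U. card (nb U u)) < b * card U" by (simp only: of_nat_less_iff)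
  qed
qed

lemma pcf_chromatic_number_le:
  assumes G: "pair_graph G" and "simple_adjacency.pcf_on (parcs G) (pverts G) k c"
  shows "\<chi>\<^sub>p\<^sub>c\<^sub>f G \<le> k"
proof -
  interpret simple_adjacency "parcs G" by (rule pair_graph_simple_adjacency[OF G])
  interpret pair_graph G by (rule G)
  have nbhd: "nbhd G x = nb (pverts G) x" for x
    using in_arcsD2 by (auto simp: nbhd_def nb_def)
  have c: "proper_on (pverts G) k c"
    and cf: "\<And>x. x \<in> pverts G \<Longrightarrow> nb (pverts G) x \<noteq> {} \<Longrightarrow> \<exists>i. unique_at (pverts G) c x i"
    using assms(2) unfolding pcf_on_def by blast+
  have "card (c ` pverts G) \<le> card {..<k}"
    using c by (intro card_mono) (auto simp: proper_on_def)
  moreover have "proper_coloring G c"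
    using c in_arcsD1 unfolding proper_coloring_def proper_on_def nbhd[symmetric] nbhd_def by fastforce
  moreover have "conflict_free G c"
    unfolding conflict_free_def nbhd
  proof (intro ballI impI)
    fix x assume "x \<in> pverts G" "nb (pverts G) x \<noteq> {}"
    then obtain i w where w: "w \<in> nb (pverts G) x" "c w = i" "\<And>y. y \<in> nb (pverts G) x \<Longrightarrow> c y = i \<Longrightarrow> y = w"
      using cf unfolding unique_at_def by metis
    have "{y \<in> nb (pverts G) x. c y = i} = {w}"
    proof
      show "{y \<in> nb (pverts G) x. c y = i} \<subseteq> {w}" using w(3) by blast
    qed (use w(1,2) in blast)
    then have "card {y \<in> nb (pverts G) x. c y = i} = 1" by simp
    then show "\<exists>i. card {y \<in> nb (pverts G) x. c y = i} = 1" by blast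
  qed
  ultimately have "pcf_coloring G k c" by (simp add: pcf_coloring_def)
  then show ?thesis unfolding pcf_chromatic_number_def by (intro Least_le) blast
qed

text \<open>A set without an edge to its complement would trap every walk that starts in it.\<close>

lemma connected_imp_connected_on:
  assumes G: "pair_graph G" and "Digraph_Component.connected (with_proj G)"
  shows "pverts G \<noteq> {}" "simple_adjacency.connected_on (parcs G) (pverts G)"
proof -
  interpret simple_adjacency "parcs G" by (rule pair_graph_simple_adjacency[OF G])
  interpret pair_graph G by (rule G)
  have sc: "strongly_connected (with_proj G)"
    using symmetric_connected_imp_strongly_connected[OF sym_arcs assms(2)] .
  then show "pverts G \<noteq> {}" by (simp add: strongly_connected_def)
  show "connected_on (pverts G)"
    unfolding connected_on_def
  proof (intro allI impI, rule ccontr)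
    fix A assume A: "A \<subseteq> pverts G" "A \<noteq> {}" "A \<noteq> pverts G"
      and no: "\<not> (\<exists>x\<in>A. \<exists>y\<in>pverts G - A. (x, y) \<in> parcs G)"
    obtain a b where ab: "a \<in> A" "b \<in> pverts G" "b \<notin> A" using A by blast
    have "a \<rightarrow>\<^sup>*\<^bsub>with_proj G\<^esub> b" using sc ab A(1) by (auto simp: strongly_connected_def)
    then have "b \<in> A" by (rule reachable_closed[OF _ ab(1)]) (use no in auto)
    then show False using ab(3) by simp
  qed
qed

theorem theorem5p1:
  fixes G :: "'a pair_pre_digraph" and m :: real
  assumes "pair_graph G"
    and "Digraph_Component.connected (with_proj G)"
    and "mad G = m"
  shows "(m < 8/3 \<longrightarrow> \<chi>\<^sub>p\<^sub>c\<^sub>f G \<le> 6) \<and>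
         (m < 5/2 \<longrightarrow> \<chi>\<^sub>p\<^sub>c\<^sub>f G \<le> 5) \<and>
         (m < 24/11 \<longrightarrow> G \<notin> \<F> \<longrightarrow> \<chi>\<^sub>p\<^sub>c\<^sub>f G \<le> 4)"
proof -
  interpret simple_adjacency "parcs G" by (rule pair_graph_simple_adjacency[OF assms(1)])
  interpret pair_graph G by (rule assms(1))
  \<comment> \<open>As 5/2 < 8/3, this bound yields both of the first two claims.\<close>
  have five: "\<chi>\<^sub>p\<^sub>c\<^sub>f G \<le> 5" if "m < 8/3"
  proof -
    have "sparse 3 8 (pverts G)" using that assms(3) by (intro sparse_of_mad[OF assms(1)]) simp_all
    then show ?thesis
      using sparse_8_3_pcf_5[OF pair_finite_verts] pcf_chromatic_number_le[OF assms(1)] by blast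
  qed
  have four: "\<chi>\<^sub>p\<^sub>c\<^sub>f G \<le> 4" if "m < 24/11" "G \<notin> \<F>"
  proof -
    have sparse: "sparse 11 24 (pverts G)" using that(1) assms(3) by (intro sparse_of_mad[OF assms(1)]) simp_all
    have ne: "pverts G \<noteq> {}" and conn: "connected_on (pverts G)"
      using connected_imp_connected_on[OF assms(1,2)] by blast+
    have "\<exists>c. pcf_on (pverts G) 4 c"
    proof (cases "pentagon_cactus (pverts G)")
      case True
      \<comment> \<open>A cactus with at least two vertices would belong to \<open>\<F>\<close>, so
        at most one vertex is left.\<close>
      then have "card (pverts G) \<le> 4"
        using pentagon_cactus_in_C5_block_graphs[OF assms(1,2)] that(2) by linarith
      then show ?thesis by (rule card_le_imp_pcf_on[OF pair_finite_verts])
    next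
      case False
      then show ?thesis
        using connected_sparse_24_11_pcf_4[OF pair_finite_verts ne conn sparse] by blast
    qed
    then show ?thesis using pcf_chromatic_number_le[OF assms(1)] by blast
  qed
  show ?thesis using five four by auto
qed

end
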